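(* Let $\Lambda_R\subseteq\Lambda\subseteq\Lambda_W$ be an arbitrary intermediate lattice for an irreducible root system (of a finite-dimensional simple complex Lie algebra $\mathfrak g$). Then the order of the group $G=\Lambda/\operatorname{Cent}_{\Lambda_R}(\Lambda)$ is odd if and only if both of the following conditions are satisfied: 1) $|\Lambda/\Lambda_R|$ is odd; 2) $\ell$ is odd, or ($\ell\equiv2\bmod4$, $\mathfrak g$ is of type $B_n$, and $\Lambda=\Lambda_R$), where type $B_n$ includes $B_1=A_1$.
   Context: $(\cdot,\cdot)$ is the invariant bilinear form normalized so that short roots satisfy $(\alpha,\alpha)=2$ (for simply-laced types all roots satisfy $(\alpha,\alpha)=2$); $d_i=(\alpha_i,\alpha_i)/2$ for the simple roots $\alpha_i$. $\Lambda_R$ is the root lattice, $\Lambda_W$ the weight lattice spanned by the $\lambda_i$ with $(\lambda_i,\alpha_j)=\delta_{ij}d_i$. $\ell\ge1$ is an integer, and $\operatorname{Cent}_{\Lambda_R}(\Lambda)=\{\nu\in\Lambda_R\mid(\nu,\mu)\in\ell\mathbb Z\ \forall\mu\in\Lambda\}$. Type $B_2$ is the same as type $C_2$. *)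

theory Defs
  imports
    "HOL-Analysis.Analysis"
    "HOL-Algebra.Coset"
    "HOL-Computational_Algebra.Group_Closure"
begin

text \<open>
  Reduced crystallographic root systems in a Euclidean space.  The ambient inner product is
  invariant under the Weyl group, but its scaling is arbitrary.
\<close>

definition root_reflection :: "'a::euclidean_space \<Rightarrow> 'a \<Rightarrow> 'a" where
  "root_reflection \<alpha> x = x - (2 * (x \<bullet> \<alpha>) / (\<alpha> \<bullet> \<alpha>)) *\<^sub>R \<alpha>"

definition cartan_number :: "'a::euclidean_space \<Rightarrow> 'a \<Rightarrow> real" where
  "cartan_number x y = 2 * (x \<bullet> y) / (y \<bullet> y)"

definition root_system :: "'a::euclidean_space set \<Rightarrow> bool" where
  "root_system \<Phi> \<longleftrightarrow>
     finite \<Phi> \<and> 0 \<notin> \<Phi> \<and> span \<Phi> = UNIV \<and>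
     (\<forall>\<alpha>\<in>\<Phi>. root_reflection \<alpha> ` \<Phi> = \<Phi>) \<and>
     (\<forall>\<alpha>\<in>\<Phi>. \<forall>\<beta>\<in>\<Phi>. cartan_number \<beta> \<alpha> \<in> \<int>) \<and>
     (\<forall>\<alpha>\<in>\<Phi>. \<forall>c. c *\<^sub>R \<alpha> \<in> \<Phi> \<longrightarrow> c = 1 \<or> c = -1)"

definition irreducible_root_system :: "'a::euclidean_space set \<Rightarrow> bool" where
  "irreducible_root_system \<Phi> \<longleftrightarrow>
     root_system \<Phi> \<and> \<Phi> \<noteq> {} \<and>
     \<not> (\<exists>\<Phi>\<^sub>1 \<Phi>\<^sub>2. \<Phi>\<^sub>1 \<noteq> {} \<and> \<Phi>\<^sub>2 \<noteq> {} \<and> \<Phi> = \<Phi>\<^sub>1 \<union> \<Phi>\<^sub>2 \<and>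
          (\<forall>\<alpha>\<in>\<Phi>\<^sub>1. \<forall>\<beta>\<in>\<Phi>\<^sub>2. \<alpha> \<bullet> \<beta> = 0))"

definition simple_roots :: "'a::euclidean_space set \<Rightarrow> 'a set \<Rightarrow> bool" where
  "simple_roots \<Phi> \<Delta> \<longleftrightarrow>
     \<Delta> \<subseteq> \<Phi> \<and> independent \<Delta> \<and>
     (\<forall>\<beta>\<in>\<Phi>. \<exists>c :: 'a \<Rightarrow> int. \<beta> = (\<Sum>\<alpha>\<in>\<Delta>. of_int (c \<alpha>) *\<^sub>R \<alpha>) \<and>
        ((\<forall>\<alpha>\<in>\<Delta>. c \<alpha> \<ge> 0) \<or> (\<forall>\<alpha>\<in>\<Delta>. c \<alpha> \<le> 0)))"

text \<open>
  Type \<open>B\<^sub>n\<close>: the \<open>n\<close> simple roots can be numbered so that they have the Cartan matrix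
  \<open>B\<^sub>n\<close>, with \<open>\<alpha>\<^sub>n\<close> the short simple root if \<open>n \<ge> 2\<close>.
  For \<open>n = 1\<close> the matrix is \<open>(2)\<close>, so that \<open>B\<^sub>1 = A\<^sub>1\<close>; for \<open>n = 2\<close> it is that of
  \<open>C\<^sub>2\<close> with the numbering reversed.
\<close>

definition type_B :: "nat \<Rightarrow> 'a::euclidean_space set \<Rightarrow> bool" where
  "type_B n \<Delta> \<longleftrightarrow> n \<ge> 1 \<and>
     (\<exists>a. bij_betw a {1..n} \<Delta> \<and>
        (\<forall>i\<in>{1..n}. \<forall>j\<in>{1..n}. cartan_number (a i) (a j) =
           (if i = j then 2
            else if i + 1 = n \<and> j = n then -2
            else if i + 1 = j \<or> j + 1 = i then -1
            else 0)))"

definition short_root :: "'a::euclidean_space set \<Rightarrow> 'a \<Rightarrow> bool" where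
  "short_root \<Phi> \<alpha> \<longleftrightarrow> \<alpha> \<in> \<Phi> \<and> (\<forall>\<beta>\<in>\<Phi>. norm \<alpha> \<le> norm \<beta>)"

text \<open>
  Invariance under the reflections in all roots is invariance under the Weyl group.  In the
  simply-laced case every root is short in the above sense.
\<close>

definition normalized_invariant_form ::
    "'a::euclidean_space set \<Rightarrow> ('a \<Rightarrow> 'a \<Rightarrow> real) \<Rightarrow> bool" where
  "normalized_invariant_form \<Phi> B \<longleftrightarrow>
     bilinear B \<and> (\<forall>x y. B x y = B y x) \<and>
     (\<forall>\<alpha>\<in>\<Phi>. \<forall>x y. B (root_reflection \<alpha> x) (root_reflection \<alpha> y) = B x y) \<and>
     (\<forall>\<alpha>. short_root \<Phi> \<alpha> \<longrightarrow> B \<alpha> \<alpha> = 2)"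

definition root_lattice :: "'a::euclidean_space set \<Rightarrow> 'a set" where
  "root_lattice \<Phi> = group_closure \<Phi>"

definition fundamental_weight ::
    "('a::euclidean_space \<Rightarrow> 'a \<Rightarrow> real) \<Rightarrow> 'a set \<Rightarrow> 'a \<Rightarrow> 'a \<Rightarrow> bool" where
  "fundamental_weight B \<Delta> \<alpha> w \<longleftrightarrow>
     (\<forall>\<beta>\<in>\<Delta>. B w \<beta> = (if \<alpha> = \<beta> then B \<alpha> \<alpha> / 2 else 0))"

definition weight_lattice ::
    "('a::euclidean_space \<Rightarrow> 'a \<Rightarrow> real) \<Rightarrow> 'a set \<Rightarrow> 'a set" where
  "weight_lattice B \<Delta> = group_closure {w. \<exists>\<alpha>\<in>\<Delta>. fundamental_weight B \<Delta> \<alpha> w}"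

definition Cent ::
    "('a::euclidean_space \<Rightarrow> 'a \<Rightarrow> real) \<Rightarrow> nat \<Rightarrow> 'a set \<Rightarrow> 'a set \<Rightarrow> 'a set" where
  "Cent B l \<Lambda>' \<Lambda> = {\<nu>\<in>\<Lambda>'. \<forall>\<mu>\<in>\<Lambda>. \<exists>k::int. B \<nu> \<mu> = of_nat l * of_int k}"

definition additive_group :: "'a::ab_group_add set \<Rightarrow> 'a monoid" where
  "additive_group A = \<lparr>carrier = A, monoid.mult = (+), one = 0\<rparr>"

end

theory Submission
  imports Defs "HOL-Algebra.Sylow" "HOL-Algebra.Multiplicative_Group"
begin

text \<open>
  Write \<open>\<Lambda>\<^sub>R\<close> for the root lattice and \<open>K\<close> for the centralizer of \<open>\<Lambda>\<close> in it.  A group has odd order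
  if and only if it is finite and killed by an odd exponent, so the question is whether some odd
  \<open>k\<close> satisfies \<open>k \<Lambda> \<subseteq> K\<close>; finiteness is inherited along \<open>K \<subseteq> \<Lambda>\<^sub>R \<subseteq> \<Lambda>\<close> because
  \<open>l \<Lambda>\<^sub>R \<subseteq> K\<close> and \<open>\<Lambda>\<^sub>R\<close> is finitely generated
  (\<open>odd_order_additive_quotient_iff\<close>, \<open>finite_residues_group_closure\<close>).

  The inclusion \<open>l \<Lambda>\<^sub>R \<subseteq> K\<close> holds as the form \<open>B\<close> is integral on \<open>\<Lambda>\<^sub>R \<times> \<Lambda>\<close>
  (\<open>form_weight_lattice\<close>), and it settles odd \<open>l\<close>.  If \<open>l\<close> is even and \<open>k \<Lambda> \<subseteq> K\<close> with \<open>k\<close> odd,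
  then \<open>l\<close> divides \<open>k B \<nu> \<mu>\<close> for \<open>\<nu> \<in> \<Lambda>\<^sub>R\<close> and \<open>\<mu> \<in> \<Lambda>\<close>, so all these values of \<open>B\<close> are
  even; and \<open>4\<close> cannot divide \<open>l\<close>, as \<open>B\<close> takes the value \<open>2\<close> on a short root.  Conversely, if
  \<open>l mod 4 = 2\<close> and all values are even, then \<open>l / 2\<close> is odd and multiplies \<open>\<Lambda>\<^sub>R\<close> into \<open>K\<close>.

  What remains is that \<open>B\<close> is even on \<open>\<Lambda>\<^sub>R \<times> \<Lambda>\<close> exactly for type \<open>B\<^sub>n\<close> with \<open>\<Lambda> = \<Lambda>\<^sub>R\<close>.  One
  direction is read off the Cartan matrix (\<open>type_B_form_even\<close>).  For the other one
  (\<open>form_even_imp_type_B\<close>), the form \<open>B / 2\<close> is integral on \<open>\<Lambda>\<^sub>R\<close> and gives short roots norm \<open>1\<close>,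
  so short roots that are not proportional are orthogonal.  By irreducibility they span, hence up
  to sign they form an orthonormal basis \<open>e\<^sub>1, \<dots>, e\<^sub>n\<close>.  Every weight in \<open>\<Lambda>\<close> has integral coordinates in
  it, which gives \<open>\<Lambda> = \<Lambda>\<^sub>R\<close>.  Integrality of the Cartan numbers bounds the other roots to
  the form \<open>\<plusminus>e\<^sub>i \<plusminus> e\<^sub>j\<close> (\<open>root_cases\<close>), and irreducibility makes every difference \<open>e\<^sub>i - e\<^sub>j\<close> a
  root (\<open>root_diff\<close>).  Choose signs so that the heights of the \<open>e\<^sub>i\<close> are positive.  These heights
  are distinct integers, and a simple root has height \<open>1\<close>, so it is either the \<open>e\<^sub>i\<close> of height
  \<open>1\<close> or a difference of two \<open>e\<^sub>i\<close> with consecutive heights.  As there are \<open>n\<close> simple roots,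
  the heights must be exactly \<open>1, \<dots>, n\<close> and every such difference occurs
  (\<open>simple_roots_eq_frame_differences\<close>), which is the standard base of \<open>B\<^sub>n\<close>.
\<close>

section \<open>Quotients of odd order\<close>

lemma additive_group_simps [simp]:
  "carrier (additive_group A) = A"
  "x \<otimes>\<^bsub>additive_group A\<^esub> y = x + y"
  "\<one>\<^bsub>additive_group A\<^esub> = 0"
  by (simp_all add: additive_group_def)

lemma comm_group_additive_group:
  assumes "(0::'a::ab_group_add) \<in> A" and diff: "\<And>x y. x \<in> A \<Longrightarrow> y \<in> A \<Longrightarrow> x - y \<in> A"
  shows "comm_group (additive_group A)"
proof (rule comm_groupI)
  have neg: "- x \<in> A" if "x \<in> A" for x
    using diff[OF assms(1) that] by simp
  show "\<exists>y\<in>carrier (additive_group A). y \<otimes>\<^bsub>additive_group A\<^esub> x = \<one>\<^bsub>additive_group A\<^esub>"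
    if "x \<in> carrier (additive_group A)" for x
    using neg that by (auto intro!: bexI[of _ "- x"])
  show "x \<otimes>\<^bsub>additive_group A\<^esub> y \<in> carrier (additive_group A)"
    if "x \<in> carrier (additive_group A)" "y \<in> carrier (additive_group A)" for x y
    using diff[of x "- y"] neg that by simp
qed (use assms in \<open>auto simp: add_ac\<close>)

lemma subgroup_additive_group_diff:
  assumes "subgroup K (additive_group (UNIV::'a::ab_group_add set))"
  shows "0 \<in> K" and "\<And>x y. x \<in> K \<Longrightarrow> y \<in> K \<Longrightarrow> x - y \<in> K"
proof -
  interpret subgroup K "additive_group UNIV" by fact
  interpret G: comm_group "additive_group (UNIV::'a set)"
    by (rule comm_group_additive_group) auto
  have inv: "inv\<^bsub>additive_group UNIV\<^esub> y = - y" for y :: 'a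
    by (rule G.inv_equality) auto
  show "0 \<in> K" using one_closed by simp
  show "x - y \<in> K" if "x \<in> K" "y \<in> K" for x y
    using m_closed[OF that(1) m_inv_closed[OF that(2)]] by (simp add: inv)
qed

lemma subgroup_additive_groupI:
  assumes "(0::'a::ab_group_add) \<in> K" and diff: "\<And>x y. x \<in> K \<Longrightarrow> y \<in> K \<Longrightarrow> x - y \<in> K"
  shows "subgroup K (additive_group UNIV)"
proof -
  interpret G: comm_group "additive_group (UNIV::'a set)"
    by (rule comm_group_additive_group) auto
  have neg: "- y \<in> K" if "y \<in> K" for y using diff[OF assms(1) that] by simp
  have inv: "inv\<^bsub>additive_group UNIV\<^esub> y = - y" for y :: 'a
    by (rule G.inv_equality) auto
  show ?thesis
  proof (rule G.subgroupI)
    show "a \<otimes>\<^bsub>additive_group UNIV\<^esub> b \<in> K" if "a \<in> K" "b \<in> K" for a b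
      using diff[OF that(1) neg[OF that(2)]] by simp
  qed (use assms neg inv in auto)
qed

text \<open>
  A finite group of even order contains a subgroup of order \<open>2\<close> by Sylow's theorem, and its
  nontrivial element is not killed by an odd exponent.  An infinite group has \<open>order\<close> zero,
  which is even.
\<close>
lemma odd_order_iff_odd_exponent:
  assumes "group G"
  shows "odd (order G) \<longleftrightarrow> finite (carrier G) \<and> (\<exists>k. odd k \<and> (\<forall>x\<in>carrier G. x [^]\<^bsub>G\<^esub> (k::nat) = \<one>\<^bsub>G\<^esub>))"
proof
  interpret group G by fact
  assume odd: "odd (order G)"
  then have "finite (carrier G)"
    unfolding order_def by (rule contrapos_np) simp
  then show "finite (carrier G) \<and> (\<exists>k. odd k \<and> (\<forall>x\<in>carrier G. x [^]\<^bsub>G\<^esub> (k::nat) = \<one>\<^bsub>G\<^esub>))"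
    using odd pow_order_eq_1 by blast
next
  interpret group G by fact
  assume "finite (carrier G) \<and> (\<exists>k. odd k \<and> (\<forall>x\<in>carrier G. x [^]\<^bsub>G\<^esub> (k::nat) = \<one>\<^bsub>G\<^esub>))"
  then obtain k :: nat where fin: "finite (carrier G)" and k: "odd k"
    and exponent: "\<And>x. x \<in> carrier G \<Longrightarrow> x [^]\<^bsub>G\<^esub> k = \<one>\<^bsub>G\<^esub>" by auto
  show "odd (order G)"
  proof
    assume "even (order G)"
    then obtain m where "order G = 2 ^ 1 * m" by auto
    from sylow_thm[OF two_is_prime_nat assms this fin]
    obtain H where H: "subgroup H G" "card H = 2" by auto
    then interpret H: subgroup H G by simp
    obtain x where x: "x \<in> H" "x \<noteq> \<one>\<^bsub>G\<^esub>"
      using H(2) by (metis card_2_iff')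
    have xG: "x \<in> carrier G" using x H.subset by auto
    have "order (G\<lparr>carrier := H\<rparr>) = 2" using H(2) by (simp add: order_def)
    then have "x [^]\<^bsub>G\<^esub> (2::nat) = \<one>\<^bsub>G\<^esub>"
      using group.pow_order_eq_1[OF H.subgroup_is_group[OF assms], of x] x
      by (simp flip: nat_pow_consistent)
    moreover obtain j where "k = 2 * j + 1" using k by (elim oddE)
    then have "x [^]\<^bsub>G\<^esub> k = (x [^]\<^bsub>G\<^esub> (2::nat)) [^]\<^bsub>G\<^esub> j \<otimes>\<^bsub>G\<^esub> x"
      by (simp add: nat_pow_pow[OF xG] xG)
    ultimately have "x [^]\<^bsub>G\<^esub> k = x" using xG by simp
    with exponent[OF xG] x show False by simp
  qed
qed

text \<open>
  Phrasing finiteness by representatives and the exponent by multiples keeps cosets out of all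
  later arguments, where chains of lattices \<open>K \<subseteq> H \<subseteq> G\<close> are compared.
\<close>
lemma odd_order_additive_quotient_iff:
  fixes G K :: "'a::real_vector set"
  assumes G: "subgroup G (additive_group UNIV)" and K: "subgroup K (additive_group UNIV)"
    and "K \<subseteq> G"
  shows "odd (order (additive_group G Mod K)) \<longleftrightarrow>
    (\<exists>F. finite F \<and> (\<forall>x\<in>G. \<exists>y\<in>F. x - y \<in> K)) \<and>
    (\<exists>k::nat. odd k \<and> (\<forall>x\<in>G. of_nat k *\<^sub>R x \<in> K))"
proof -
  note Gs = subgroup_additive_group_diff[OF G] and Ks = subgroup_additive_group_diff[OF K]
  have Kneg: "- x \<in> K" if "x \<in> K" for x using Ks(2)[OF Ks(1) that] by simp
  have Kadd: "x + y \<in> K" if "x \<in> K" "y \<in> K" for x y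
    using Ks(2)[OF that(1) Kneg[OF that(2)]] by simp
  interpret G: comm_group "additive_group G"
    by (rule comm_group_additive_group) (use Gs in auto)
  have inv: "inv\<^bsub>additive_group G\<^esub> y = - y" if "y \<in> G" for y
    using that Gs(2)[OF Gs(1) that] by (intro G.inv_equality) auto
  have "subgroup K (additive_group G)"
    by (rule G.subgroupI) (use Ks Kadd Kneg \<open>K \<subseteq> G\<close> inv in auto)
  then interpret normal K "additive_group G"
    by (simp add: G.subgroup_imp_normal)
  let ?Q = "additive_group G Mod K"
  let ?c = "\<lambda>x. K #>\<^bsub>additive_group G\<^esub> x"
  have carrier: "carrier ?Q = ?c ` G"
    by (auto simp: carrier_FactGroup)
  have coset: "?c x = {y. y - x \<in> K}" for x
    by (force simp: r_coset_def)
  have coset_eq: "?c x = ?c y \<longleftrightarrow> x - y \<in> K" for x y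
  proof
    assume "?c x = ?c y"
    moreover have "x \<in> ?c x" using Ks(1) by (simp add: coset)
    ultimately show "x - y \<in> K" by (simp add: coset)
  next
    assume xy: "x - y \<in> K"
    have "z - x \<in> K \<longleftrightarrow> z - y \<in> K" for z
      using Kadd[of "z - x" "x - y"] Ks(2)[of "z - y" "x - y"] xy by auto
    then show "?c x = ?c y" by (simp add: coset)
  qed
  have pow: "x [^]\<^bsub>additive_group G\<^esub> (k::nat) = of_nat k *\<^sub>R x" for x k
    by (induction k) (simp_all add: nat_pow_def algebra_simps)
  have cpow: "?c x [^]\<^bsub>?Q\<^esub> (k::nat) = \<one>\<^bsub>?Q\<^esub> \<longleftrightarrow> of_nat k *\<^sub>R x \<in> K" if "x \<in> G" for x k
  proof -
    have one: "\<one>\<^bsub>?Q\<^esub> = ?c 0" by (simp add: FactGroup_def coset)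
    have "?c x [^]\<^bsub>?Q\<^esub> k = ?c (of_nat k *\<^sub>R x)"
      using that by (simp add: FactGroup_pow pow)
    then show ?thesis unfolding one coset_eq by (simp add: coset_eq)
  qed
  have fin: "finite (carrier ?Q) \<longleftrightarrow> (\<exists>F. finite F \<and> (\<forall>x\<in>G. \<exists>y\<in>F. x - y \<in> K))"
  proof
    assume "finite (carrier ?Q)"
    then obtain F where "finite F" "F \<subseteq> G" "?c ` G = ?c ` F"
      unfolding carrier by (metis finite_subset_image subset_refl)
    then show "\<exists>F. finite F \<and> (\<forall>x\<in>G. \<exists>y\<in>F. x - y \<in> K)"
      by (metis coset_eq image_iff)
  next
    assume "\<exists>F. finite F \<and> (\<forall>x\<in>G. \<exists>y\<in>F. x - y \<in> K)"
    then obtain F where "finite F" "\<forall>x\<in>G. \<exists>y\<in>F. x - y \<in> K" by auto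
    then have "carrier ?Q \<subseteq> ?c ` F" unfolding carrier using coset_eq by blast
    then show "finite (carrier ?Q)" using \<open>finite F\<close> finite_surj by blast
  qed
  show ?thesis
    unfolding odd_order_iff_odd_exponent[OF factorgroup_is_group] fin
    using cpow by (auto simp: carrier)
qed

section \<open>Integer combinations\<close>

lemma group_closure_least:
  assumes "S \<subseteq> H" "0 \<in> H" "\<And>x y. x \<in> H \<Longrightarrow> y \<in> H \<Longrightarrow> x - y \<in> H"
  shows "group_closure S \<subseteq> H"
proof
  fix x assume "x \<in> group_closure S"
  then show "x \<in> H" by induction (use assms in auto)
qed

lemma group_closure_of_int_scaleR:
  fixes x :: "'a::real_vector"
  assumes "x \<in> group_closure S"
  shows "of_int k *\<^sub>R x \<in> group_closure S"
proof -
  have nat: "real n *\<^sub>R x \<in> group_closure S" for n :: nat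
    by (induction n) (simp_all add: scaleR_left_distrib group_closure_add assms)
  show ?thesis
  proof (cases k)
    case (neg n)
    have "- (real (Suc n) *\<^sub>R x) \<in> group_closure S" using nat[of "Suc n"] by (simp del: of_nat_Suc)
    then show ?thesis by (simp add: neg del: of_nat_Suc)
  qed (use nat in simp)
qed

lemma group_closure_sum_of_int_scaleR:
  fixes S :: "'a::real_vector set"
  assumes "A \<subseteq> S"
  shows "(\<Sum>x\<in>A. of_int (c x) *\<^sub>R x) \<in> group_closure S"
  using assms
  by (induction A rule: infinite_finite_induct)
    (simp_all add: group_closure_add group_closure_of_int_scaleR group_closure.base)

lemma group_closure_finite_combination:
  fixes S :: "'a::real_vector set"
  assumes "finite S" "x \<in> group_closure S"
  obtains c :: "'a \<Rightarrow> int" where "x = (\<Sum>y\<in>S. of_int (c y) *\<^sub>R y)"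
proof -
  from assms(2) have "\<exists>c::'a \<Rightarrow> int. x = (\<Sum>y\<in>S. of_int (c y) *\<^sub>R y)"
  proof induction
    case (base s)
    show ?case
    proof (cases "s \<in> S")
      case True
      have "(\<Sum>y\<in>S. of_int (if y = s then 1 else 0) *\<^sub>R y) = (\<Sum>y\<in>S. if y = s then s else 0)"
        by (intro sum.cong) auto
      then have "s = (\<Sum>y\<in>S. of_int (if y = s then 1 else 0) *\<^sub>R y)"
        using True assms(1) by simp
      then show ?thesis by (intro exI)
    next
      case False
      then show ?thesis using base by (intro exI[of _ "\<lambda>_. 0"]) auto
    qed
  next
    case (diff s t)
    then obtain c d :: "'a \<Rightarrow> int" where "s = (\<Sum>y\<in>S. of_int (c y) *\<^sub>R y)" "t = (\<Sum>y\<in>S. of_int (d y) *\<^sub>R y)"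
      by blast
    then show ?case
      by (intro exI[of _ "\<lambda>y. c y - d y"]) (simp add: sum_subtractf scaleR_left_diff_distrib)
  qed
  with that show ?thesis by blast
qed

text \<open>Representatives are obtained by reducing the coefficients modulo \<open>l\<close>.\<close>
lemma finite_residues_group_closure:
  fixes S :: "'a::real_vector set"
  assumes "finite S" "l \<ge> 1"
  obtains F where "finite F" "\<And>x. x \<in> group_closure S \<Longrightarrow> \<exists>y\<in>F. \<exists>z\<in>group_closure S. x - y = real l *\<^sub>R z"
proof -
  let ?comb = "\<lambda>c :: 'a \<Rightarrow> int. \<Sum>y\<in>S. of_int (c y) *\<^sub>R y"
  define F where "F = ?comb ` (S \<rightarrow>\<^sub>E {0..<int l})"
  have "finite F" unfolding F_def using assms(1) by (intro finite_imageI finite_PiE) auto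
  moreover have "\<exists>y\<in>F. \<exists>z\<in>group_closure S. x - y = real l *\<^sub>R z" if x: "x \<in> group_closure S" for x
  proof -
    obtain c where c: "x = ?comb c" using group_closure_finite_combination[OF assms(1) x] .
    define r where "r = restrict (\<lambda>y. c y mod int l) S"
    have "?comb r \<in> F" unfolding F_def
      using assms(2) by (intro imageI) (auto simp: r_def)
    moreover have "?comb (\<lambda>y. c y div int l) \<in> group_closure S"
      by (rule group_closure_sum_of_int_scaleR) simp
    moreover have "x - ?comb r = real l *\<^sub>R ?comb (\<lambda>y. c y div int l)"
    proof -
      have "real_of_int (c y) - of_int (r y) = real l * of_int (c y div int l)" if "y \<in> S" for y
      proof -
        have "c y = int l * (c y div int l) + r y" using that by (simp add: r_def)
        then have "real_of_int (c y) = of_int (int l * (c y div int l) + r y)" by (rule arg_cong)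
        then show ?thesis by simp
      qed
      then show ?thesis
        by (simp add: c scaleR_sum_right flip: sum_subtractf scaleR_left_diff_distrib)
    qed
    ultimately show ?thesis by blast
  qed
  ultimately show ?thesis by (rule that)
qed

text \<open>
  Integrality is the case \<open>c = 1\<close>, and evenness the case \<open>c = 2\<close>.
\<close>
lemma group_closure_linear_multiple:
  fixes f :: "'a::real_vector \<Rightarrow> real"
  assumes "linear f" and "\<And>s. s \<in> S \<Longrightarrow> \<exists>k::int. f s = c * of_int k" and "x \<in> group_closure S"
  shows "\<exists>k::int. f x = c * of_int k"
  using assms(3)
proof induction
  case (base s)
  then show ?case
    using assms(2) linear_0[OF assms(1)] by (cases "s = 0") (auto intro!: exI[of _ 0])
next
  case (diff s t)
  then obtain i j :: int where "f s = c * of_int i" "f t = c * of_int j" by auto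
  then show ?case
    by (intro exI[of _ "i - j"]) (simp add: linear_diff[OF assms(1)] algebra_simps)
qed

lemma bilinear_group_closure_multiple:
  fixes B :: "'a::real_vector \<Rightarrow> 'b::real_vector \<Rightarrow> real"
  assumes bil: "bilinear B"
    and gen: "\<And>s t. s \<in> S \<Longrightarrow> t \<in> T \<Longrightarrow> \<exists>k::int. B s t = c * of_int k"
    and x: "x \<in> group_closure S" and y: "y \<in> group_closure T"
  shows "\<exists>k::int. B x y = c * of_int k"
proof (rule group_closure_linear_multiple[OF _ _ x])
  show "linear (\<lambda>x. B x y)" using bil by (simp add: bilinear_def)
  fix s assume "s \<in> S"
  show "\<exists>k::int. B s y = c * of_int k"
    by (rule group_closure_linear_multiple[OF _ _ y])
      (use bil gen[OF \<open>s \<in> S\<close>] in \<open>auto simp: bilinear_def\<close>)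
qed

section \<open>Irreducible root systems and their invariant form\<close>

lemma root_lattice_eq_group_closure_simple:
  assumes "simple_roots \<Phi> \<Delta>"
  shows "root_lattice \<Phi> = group_closure \<Delta>"
proof
  have "\<beta> \<in> group_closure \<Delta>" if \<beta>: "\<beta> \<in> \<Phi>" for \<beta>
  proof -
    obtain c :: "'a \<Rightarrow> int" where "\<beta> = (\<Sum>\<alpha>\<in>\<Delta>. of_int (c \<alpha>) *\<^sub>R \<alpha>)"
      using assms \<beta> unfolding simple_roots_def by metis
    then show ?thesis using group_closure_sum_of_int_scaleR[of \<Delta> \<Delta> c] by simp
  qed
  then show "root_lattice \<Phi> \<subseteq> group_closure \<Delta>"
    unfolding root_lattice_def by (intro group_closure_least) (auto intro: group_closure.diff)
  have "\<Delta> \<subseteq> \<Phi>" using assms by (simp add: simple_roots_def)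
  then show "group_closure \<Delta> \<subseteq> root_lattice \<Phi>"
    unfolding root_lattice_def
    by (intro group_closure_least) (auto intro: group_closure.base group_closure.diff)
qed

lemma ex_short_root:
  assumes "irreducible_root_system \<Phi>"
  obtains s where "short_root \<Phi> s"
proof -
  have "finite \<Phi>" "\<Phi> \<noteq> {}"
    using assms by (auto simp: irreducible_root_system_def root_system_def)
  then have "short_root \<Phi> (ARG_MIN norm x. x \<in> \<Phi>)"
    using arg_min_if_finite[of \<Phi> norm] by (auto simp: short_root_def not_less arg_min_on_def)
  then show ?thesis by (rule that)
qed

text \<open>
  Fixing one short root \<open>s\<close> names the scale of the ambient inner product: \<open>q\<close> below is the common
  squared length of all short roots, and the normalized form is \<open>2 / q\<close> times the inner product.
\<close>
locale irreducible_roots =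
  fixes \<Phi> :: "'a::euclidean_space set" and s :: 'a
  assumes irreducible: "irreducible_root_system \<Phi>" and short: "short_root \<Phi> s"
begin

abbreviation q :: real where "q \<equiv> s \<bullet> s"

lemma finite_roots: "finite \<Phi>"
  and root_nonzero: "\<alpha> \<in> \<Phi> \<Longrightarrow> \<alpha> \<noteq> 0"
  and span_roots: "span \<Phi> = UNIV"
  and reflection_root: "\<alpha> \<in> \<Phi> \<Longrightarrow> \<beta> \<in> \<Phi> \<Longrightarrow> root_reflection \<alpha> \<beta> \<in> \<Phi>"
  and cartan_number_Ints: "\<alpha> \<in> \<Phi> \<Longrightarrow> \<beta> \<in> \<Phi> \<Longrightarrow> cartan_number \<beta> \<alpha> \<in> \<int>"
  and reduced: "\<alpha> \<in> \<Phi> \<Longrightarrow> c *\<^sub>R \<alpha> \<in> \<Phi> \<Longrightarrow> c = 1 \<or> c = -1"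
proof -
  have rs: "root_system \<Phi>"
    using irreducible by (simp add: irreducible_root_system_def)
  then show "finite \<Phi>" "span \<Phi> = UNIV" "\<alpha> \<in> \<Phi> \<Longrightarrow> \<alpha> \<noteq> 0"
    by (auto simp: root_system_def)
  show "root_reflection \<alpha> \<beta> \<in> \<Phi>" if "\<alpha> \<in> \<Phi>" "\<beta> \<in> \<Phi>"
    using rs that imageI[of \<beta> \<Phi> "root_reflection \<alpha>"] by (simp add: root_system_def)
  show "cartan_number \<beta> \<alpha> \<in> \<int>" if "\<alpha> \<in> \<Phi>" "\<beta> \<in> \<Phi>"
    using rs that by (simp add: root_system_def)
  show "c = 1 \<or> c = -1" if "\<alpha> \<in> \<Phi>" "c *\<^sub>R \<alpha> \<in> \<Phi>"
    using rs that by (simp add: root_system_def)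
qed

lemma neg_root: "\<alpha> \<in> \<Phi> \<Longrightarrow> - \<alpha> \<in> \<Phi>"
  using reflection_root[of \<alpha> \<alpha>] root_nonzero[of \<alpha>] by (simp add: root_reflection_def scaleR_2)

lemma s_root: "s \<in> \<Phi>"
  using short by (simp add: short_root_def)

lemma q_pos: "q > 0"
  using root_nonzero[OF s_root] by simp

lemma inner_short: "short_root \<Phi> t \<Longrightarrow> t \<bullet> t = q"
  using short unfolding short_root_def by (metis dot_square_norm order_antisym)

lemma short_root_iff: "short_root \<Phi> t \<longleftrightarrow> t \<in> \<Phi> \<and> t \<bullet> t = q"
  using short unfolding short_root_def by (metis inner_short norm_eq short short_root_def)

lemma inner_root_reflection:
  assumes "\<alpha> \<noteq> 0"
  shows "root_reflection \<alpha> x \<bullet> root_reflection \<alpha> y = x \<bullet> y"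
  using assms by (simp add: root_reflection_def inner_diff_left inner_diff_right inner_commute field_simps)

lemma short_root_reflection:
  assumes "\<alpha> \<in> \<Phi>" "short_root \<Phi> t"
  shows "short_root \<Phi> (root_reflection \<alpha> t)"
  using assms reflection_root[of \<alpha> t] inner_root_reflection[OF root_nonzero]
  by (simp add: short_root_iff)

text \<open>
  Irreducibility as a propagation principle: a property of some root that passes between
  non-orthogonal roots holds for all roots.
\<close>
lemma nonorthogonal_closed_eq_roots:
  assumes "A \<subseteq> \<Phi>" "A \<noteq> {}"
    and closed: "\<And>\<alpha> \<beta>. \<alpha> \<in> A \<Longrightarrow> \<beta> \<in> \<Phi> \<Longrightarrow> \<alpha> \<bullet> \<beta> \<noteq> 0 \<Longrightarrow> \<beta> \<in> A"
  shows "A = \<Phi>"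
proof (rule ccontr)
  assume "A \<noteq> \<Phi>"
  then have "\<Phi> - A \<noteq> {}" "\<Phi> = A \<union> (\<Phi> - A)" "\<forall>\<alpha>\<in>A. \<forall>\<beta>\<in>\<Phi> - A. \<alpha> \<bullet> \<beta> = 0"
    using assms by auto
  with irreducible \<open>A \<noteq> {}\<close> show False unfolding irreducible_root_system_def by metis
qed

text \<open>
  Let \<open>t\<close> be a short root with \<open>\<alpha> \<bullet> t \<noteq> 0\<close> and \<open>\<beta>\<close> a root with \<open>\<alpha> \<bullet> \<beta> \<noteq> 0\<close>.  If \<open>\<beta>\<close> is
  orthogonal to \<open>t\<close>, then it is not orthogonal to the short root that arises by reflecting
  \<open>t\<close> in \<open>\<alpha>\<close>.
\<close>
lemma ex_short_root_nonorthogonal: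
  assumes "\<alpha> \<in> \<Phi>"
  obtains t where "short_root \<Phi> t" "\<alpha> \<bullet> t \<noteq> 0"
proof -
  define A where "A = {\<alpha>\<in>\<Phi>. \<exists>t. short_root \<Phi> t \<and> \<alpha> \<bullet> t \<noteq> 0}"
  have "A = \<Phi>"
  proof (rule nonorthogonal_closed_eq_roots)
    have "s \<in> A" using short s_root q_pos by (auto simp: A_def intro!: exI[of _ s])
    then show "A \<noteq> {}" by blast
    fix \<alpha> \<beta> assume "\<alpha> \<in> A" and \<beta>: "\<beta> \<in> \<Phi>" "\<alpha> \<bullet> \<beta> \<noteq> 0"
    then obtain t where \<alpha>: "\<alpha> \<in> \<Phi>" and t: "short_root \<Phi> t" "\<alpha> \<bullet> t \<noteq> 0"
      by (auto simp: A_def)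
    show "\<beta> \<in> A"
    proof (cases "\<beta> \<bullet> t = 0")
      case True
      then have "\<beta> \<bullet> root_reflection \<alpha> t \<noteq> 0"
        using \<beta> t root_nonzero[OF \<alpha>] by (simp add: root_reflection_def inner_diff_right inner_commute)
      then show ?thesis
        using \<beta> short_root_reflection[OF \<alpha> t(1)] by (auto simp: A_def)
    qed (use \<beta> t in \<open>auto simp: A_def\<close>)
  qed (auto simp: A_def)
  with assms show ?thesis by (auto simp: A_def intro: that)
qed

text \<open>
  For a short root \<open>t\<close> not orthogonal to \<open>\<alpha>\<close>, the ratio is that of the two Cartan
  numbers \<open>n\<close> and \<open>m\<close> of the pair.  Both are nonzero integers with \<open>\<bar>m\<bar> \<le> \<bar>n\<bar>\<close>, and \<open>m n \<le> 4\<close>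
  by the Cauchy-Schwarz inequality; this leaves \<open>\<bar>m\<bar> = 1\<close> or \<open>\<bar>m\<bar> = \<bar>n\<bar> = 2\<close>.
\<close>
lemma length_ratio:
  assumes \<alpha>: "\<alpha> \<in> \<Phi>"
  obtains k :: int where "k > 0" "\<alpha> \<bullet> \<alpha> = q * of_int k"
proof -
  obtain t where t: "short_root \<Phi> t" "\<alpha> \<bullet> t \<noteq> 0"
    using ex_short_root_nonorthogonal[OF \<alpha>] .
  have tt: "t \<in> \<Phi>" "t \<bullet> t = q" using t short_root_iff by auto
  obtain m n :: int where m: "cartan_number t \<alpha> = of_int m" and n: "cartan_number \<alpha> t = of_int n"
    using cartan_number_Ints[OF \<alpha> tt(1)] cartan_number_Ints[OF tt(1) \<alpha>] by (auto elim!: Ints_cases)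
  have \<alpha>pos: "\<alpha> \<bullet> \<alpha> > 0" using root_nonzero[OF \<alpha>] by simp
  have qle: "q \<le> \<alpha> \<bullet> \<alpha>" using short \<alpha> by (auto simp: short_root_def norm_le)
  have m': "of_int m * (\<alpha> \<bullet> \<alpha>) = 2 * (\<alpha> \<bullet> t)" and n': "of_int n * q = 2 * (\<alpha> \<bullet> t)"
    using m n \<alpha>pos q_pos by (auto simp: cartan_number_def tt inner_commute field_simps)
  have "m \<noteq> 0" "n \<noteq> 0" using m' n' t(2) by auto
  have cs: "(\<alpha> \<bullet> t)\<^sup>2 \<le> (\<alpha> \<bullet> \<alpha>) * q" using Cauchy_Schwarz_ineq[of \<alpha> t] tt by simp
  have eq: "real_of_int m * (\<alpha> \<bullet> \<alpha>) = of_int n * q" using m' n' by simp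
  have "real_of_int (m * n) * ((\<alpha> \<bullet> \<alpha>) * q) = (of_int m * (\<alpha> \<bullet> \<alpha>)) * (of_int n * q)"
    by simp
  also have "\<dots> = (2 * (\<alpha> \<bullet> t)) * (2 * (\<alpha> \<bullet> t))"
    unfolding m' n' ..
  also have "\<dots> \<le> 4 * ((\<alpha> \<bullet> \<alpha>) * q)" using cs by (simp add: power2_eq_square)
  finally have "real_of_int (m * n) \<le> 4" using \<alpha>pos q_pos by (simp add: mult_le_cancel_right)
  then have mn4: "m * n \<le> 4" by linarith
  \<comment> \<open>This uses that \<open>t\<close> is not longer than \<open>\<alpha>\<close>.\<close>
  have absle: "\<bar>m\<bar> \<le> \<bar>n\<bar>"
  proof -
    have "\<bar>real_of_int m\<bar> * q \<le> \<bar>real_of_int m\<bar> * (\<alpha> \<bullet> \<alpha>)" using qle by (simp add: mult_left_mono)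
    also have "\<dots> = \<bar>real_of_int n\<bar> * q" using eq \<alpha>pos q_pos by (metis abs_mult abs_of_pos)
    finally show ?thesis using q_pos by simp
  qed
  have sgn: "m * n > 0"
  proof -
    have "real_of_int m * real_of_int n * (q * q) = real_of_int m * (of_int m * (\<alpha> \<bullet> \<alpha>)) * q"
      unfolding eq by simp
    also have "\<dots> = (real_of_int m)\<^sup>2 * ((\<alpha> \<bullet> \<alpha>) * q)" by (simp add: power2_eq_square)
    also have "\<dots> > 0" using \<alpha>pos q_pos \<open>m \<noteq> 0\<close> by simp
    finally have "real_of_int m * real_of_int n > 0"
      using q_pos by (simp add: zero_less_mult_iff)
    then show ?thesis by (simp flip: of_int_mult)
  qed
  have le4: "\<bar>m\<bar> * \<bar>n\<bar> \<le> 4" using mn4 sgn by (simp flip: abs_mult)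
  have "m dvd n"
  proof (cases "\<bar>m\<bar> = 1")
    case False
    then have m2: "\<bar>m\<bar> \<ge> 2" using \<open>m \<noteq> 0\<close> by linarith
    have "2 * \<bar>n\<bar> \<le> \<bar>m\<bar> * \<bar>n\<bar>" using m2 by (intro mult_right_mono) auto
    then have "\<bar>m\<bar> = 2" "\<bar>n\<bar> = 2" using le4 m2 absle by linarith+
    then show ?thesis by (metis abs_dvd_iff dvd_abs_iff dvd_refl)
  qed (metis abs_dvd_iff one_dvd)
  then obtain k where "n = m * k" ..
  then have "\<alpha> \<bullet> \<alpha> = q * of_int k" using eq \<open>m \<noteq> 0\<close> by simp
  moreover from this have "k > 0" using \<alpha>pos q_pos by (simp add: zero_less_mult_iff)
  ultimately show ?thesis by (rule that[rotated])
qed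

text \<open>
  An invariant form is proportional to the inner product.  Against each root it is so by
  reflection invariance, with a factor depending on the root; symmetry forces equal factors at
  non-orthogonal roots, and the normalization fixes the factor at \<open>s\<close>.
\<close>
lemma normalized_invariant_form_eq:
  assumes B: "normalized_invariant_form \<Phi> B"
  shows "B x y = 2 / q * (x \<bullet> y)"
proof -
  have bil: "bilinear B" and sym: "\<And>x y. B x y = B y x"
    and inv: "\<And>\<alpha> x y. \<alpha> \<in> \<Phi> \<Longrightarrow> B (root_reflection \<alpha> x) (root_reflection \<alpha> y) = B x y"
    and norm: "\<And>t. short_root \<Phi> t \<Longrightarrow> B t t = 2"
    using B by (auto simp: normalized_invariant_form_def)
  \<comment> \<open>Invariance under the reflection in \<open>\<alpha>\<close> already determines \<open>B\<close> against \<open>\<alpha>\<close>.\<close>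
  have B_root: "B x \<alpha> = (x \<bullet> \<alpha>) * (B \<alpha> \<alpha> / (\<alpha> \<bullet> \<alpha>))" if \<alpha>: "\<alpha> \<in> \<Phi>" for x \<alpha>
  proof -
    have "root_reflection \<alpha> \<alpha> = - \<alpha>"
      using root_nonzero[OF \<alpha>] by (simp add: root_reflection_def scaleR_2)
    with inv[OF \<alpha>, of x \<alpha>] have "- B (root_reflection \<alpha> x) \<alpha> = B x \<alpha>"
      by (simp add: bilinear_rneg[OF bil])
    moreover have "B (root_reflection \<alpha> x) \<alpha> = B x \<alpha> - 2 * (x \<bullet> \<alpha>) / (\<alpha> \<bullet> \<alpha>) * B \<alpha> \<alpha>"
      by (simp add: root_reflection_def bilinear_lsub[OF bil] bilinear_lmul[OF bil])
    ultimately show ?thesis by simp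
  qed
  \<comment> \<open>The factor is the same at all roots.\<close>
  define A where "A = {\<alpha>\<in>\<Phi>. B \<alpha> \<alpha> / (\<alpha> \<bullet> \<alpha>) = 2 / q}"
  have "A = \<Phi>"
  proof (rule nonorthogonal_closed_eq_roots)
    have "s \<in> A" using s_root norm[OF short] by (simp add: A_def)
    then show "A \<noteq> {}" by blast
    fix \<alpha> \<beta> assume "\<alpha> \<in> A" "\<beta> \<in> \<Phi>" "\<alpha> \<bullet> \<beta> \<noteq> 0"
    then have "(\<alpha> \<bullet> \<beta>) * (2 / q) = (\<alpha> \<bullet> \<beta>) * (B \<beta> \<beta> / (\<beta> \<bullet> \<beta>))"
      using B_root[of \<alpha> \<beta>] B_root[of \<beta> \<alpha>] sym[of \<alpha> \<beta>] by (simp add: A_def inner_commute)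
    with \<open>\<alpha> \<bullet> \<beta> \<noteq> 0\<close> have "B \<beta> \<beta> / (\<beta> \<bullet> \<beta>) = 2 / q"
      unfolding mult_cancel_left by simp
    with \<open>\<beta> \<in> \<Phi>\<close> show "\<beta> \<in> A" by (simp add: A_def)
  qed (auto simp: A_def)
  then have root: "B x \<alpha> = 2 / q * (x \<bullet> \<alpha>)" if "\<alpha> \<in> \<Phi>" for \<alpha>
  proof -
    have "B \<alpha> \<alpha> / (\<alpha> \<bullet> \<alpha>) = 2 / q" using that \<open>A = \<Phi>\<close> by (auto simp: A_def)
    then show ?thesis by (simp only: B_root[OF that, of x] mult.commute)
  qed
  have "y \<in> span \<Phi>" by (simp add: span_roots)
  then show ?thesis
  proof (induction rule: span_induct_alt)
    case base
    then show ?case by (simp add: bilinear_rzero[OF bil])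
  next
    case (step c \<alpha> y)
    then show ?case
      by (simp add: bilinear_radd[OF bil] bilinear_rmul[OF bil] root inner_add_right algebra_simps)
  qed
qed

lemma form_root_root:
  assumes B: "normalized_invariant_form \<Phi> B" and \<alpha>: "\<alpha> \<in> \<Phi>"
  shows "B \<beta> \<alpha> = cartan_number \<beta> \<alpha> * (B \<alpha> \<alpha> / 2)"
  using root_nonzero[OF \<alpha>] by (simp add: normalized_invariant_form_eq[OF B] cartan_number_def)

lemma half_form_root_Ints:
  assumes B: "normalized_invariant_form \<Phi> B" and \<alpha>: "\<alpha> \<in> \<Phi>"
  shows "B \<alpha> \<alpha> / 2 \<in> \<int>"
proof -
  obtain k :: int where "\<alpha> \<bullet> \<alpha> = q * of_int k" using length_ratio[OF \<alpha>] .
  then show ?thesis using q_pos by (simp add: normalized_invariant_form_eq[OF B])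
qed

end

section \<open>Short roots with integral inner products\<close>

text \<open>
  The assumption \<open>gram\<close> says that the normalized form takes even values on pairs of roots.
\<close>
locale integral_roots = irreducible_roots +
  fixes \<Delta> :: "'a set"
  assumes simple: "simple_roots \<Phi> \<Delta>"
    and gram: "\<And>\<alpha> \<beta>. \<alpha> \<in> \<Phi> \<Longrightarrow> \<beta> \<in> \<Phi> \<Longrightarrow> \<exists>k::int. \<alpha> \<bullet> \<beta> = q * of_int k"
begin

definition height :: "'a \<Rightarrow> real" where
  "height = (SOME f. linear f \<and> (\<forall>\<delta>\<in>\<Delta>. f \<delta> = 1))"

lemma linear_height: "linear height" and height_simple: "\<delta> \<in> \<Delta> \<Longrightarrow> height \<delta> = 1"
proof -
  have "independent \<Delta>" using simple by (simp add: simple_roots_def)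
  from linear_independent_extend[OF this, of "\<lambda>_. 1"]
  have "\<exists>f :: 'a \<Rightarrow> real. linear f \<and> (\<forall>\<delta>\<in>\<Delta>. f \<delta> = 1)" by auto
  from someI_ex[OF this] show "linear height" "\<delta> \<in> \<Delta> \<Longrightarrow> height \<delta> = 1" by (auto simp: height_def)
qed

lemma height_simps [simp]:
  "height (x + y) = height x + height y" "height (x - y) = height x - height y" "height (- x) = - height x" "height (c *\<^sub>R x) = c * height x"
  using linear_height by (simp_all add: linear_add linear_diff linear_neg linear_cmul)

lemma simple_root: "\<delta> \<in> \<Delta> \<Longrightarrow> \<delta> \<in> \<Phi>"
  using simple by (auto simp: simple_roots_def)

text \<open>
  The coefficients of a root have one sign, so their sum vanishes only if they all do.
\<close>
lemma height_root:
  assumes "\<alpha> \<in> \<Phi>"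
  obtains k :: int where "k \<noteq> 0" "height \<alpha> = of_int k"
proof -
  obtain c :: "'a \<Rightarrow> int" where \<alpha>: "\<alpha> = (\<Sum>\<delta>\<in>\<Delta>. of_int (c \<delta>) *\<^sub>R \<delta>)"
    and c: "(\<forall>\<delta>\<in>\<Delta>. c \<delta> \<ge> 0) \<or> (\<forall>\<delta>\<in>\<Delta>. c \<delta> \<le> 0)"
    using simple assms unfolding simple_roots_def by metis
  have fin: "finite \<Delta>" using finite_roots simple_root by (meson finite_subset subsetI)
  have "height \<alpha> = (\<Sum>\<delta>\<in>\<Delta>. of_int (c \<delta>) * height \<delta>)"
    by (simp add: \<alpha> linear_sum[OF linear_height])
  then have height: "height \<alpha> = of_int (\<Sum>\<delta>\<in>\<Delta>. c \<delta>)" by (simp add: height_simple)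
  have "(\<Sum>\<delta>\<in>\<Delta>. c \<delta>) \<noteq> 0"
  proof
    assume sum0: "(\<Sum>\<delta>\<in>\<Delta>. c \<delta>) = 0"
    from c have "\<forall>\<delta>\<in>\<Delta>. c \<delta> = 0"
    proof
      assume "\<forall>\<delta>\<in>\<Delta>. c \<delta> \<ge> 0"
      then show ?thesis using sum0 sum_nonneg_eq_0_iff[OF fin, of c] by simp
    next
      assume "\<forall>\<delta>\<in>\<Delta>. c \<delta> \<le> 0"
      then show ?thesis
        using sum0 sum_nonneg_eq_0_iff[OF fin, of "\<lambda>\<delta>. - c \<delta>"] by (simp add: sum_negf)
    qed
    then have "\<alpha> = 0" by (simp add: \<alpha>)
    with root_nonzero[OF assms] show False by simp
  qed
  with height show ?thesis by (rule that[rotated])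
qed

text \<open>
  The positive short roots; they turn out to be an orthogonal basis and play the role of the
  standard basis \<open>e\<^sub>1, \<dots>, e\<^sub>n\<close>.
\<close>
definition frame :: "'a set" where
  "frame = {e. short_root \<Phi> e \<and> height e > 0}"

lemma frame_root: "e \<in> frame \<Longrightarrow> e \<in> \<Phi>" and inner_frame_self: "e \<in> frame \<Longrightarrow> e \<bullet> e = q"
  by (auto simp: frame_def short_root_iff)

lemma short_root_frame:
  assumes "short_root \<Phi> t"
  shows "t \<in> frame \<or> - t \<in> frame"
proof -
  have t: "t \<in> \<Phi>" "t \<bullet> t = q" using assms short_root_iff by auto
  obtain k :: int where "k \<noteq> 0" "height t = of_int k" using height_root[OF t(1)] .
  then show ?thesis using t neg_root by (auto simp: frame_def short_root_iff)
qed

text \<open>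
  The inner product is \<open>q k\<close> with \<open>k\<close> an integer, and \<open>\<bar>k\<bar> \<le> 1\<close> by the Cauchy-Schwarz
  inequality; \<open>k = \<plusminus>1\<close> is the case of equality.
\<close>
lemma inner_short_roots:
  assumes "short_root \<Phi> a" "short_root \<Phi> b"
  shows "a \<bullet> b = 0 \<or> a = b \<or> a = - b"
proof -
  have ab: "a \<in> \<Phi>" "b \<in> \<Phi>" "a \<bullet> a = q" "b \<bullet> b = q" using assms short_root_iff by auto
  obtain k :: int where k: "a \<bullet> b = q * of_int k" using gram[OF ab(1,2)] by blast
  have "(a \<bullet> b)\<^sup>2 \<le> q\<^sup>2 * 1"
    using Cauchy_Schwarz_ineq[of a b] ab by (simp add: power2_eq_square)
  then have "q\<^sup>2 * (of_int k)\<^sup>2 \<le> q\<^sup>2 * 1" unfolding k power_mult_distrib .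
  then have "(real_of_int k)\<^sup>2 \<le> 1" using q_pos by (subst (asm) mult_le_cancel_left_pos) auto
  then have "\<bar>real_of_int k\<bar> \<le> 1" by (simp add: abs_square_le_1)
  then consider "k = 0" | "k = 1" | "k = -1" by linarith
  then show ?thesis
  proof cases
    case 2
    then have "(a - b) \<bullet> (a - b) = 0"
      using k ab by (simp add: inner_diff_left inner_diff_right inner_commute)
    then show ?thesis by simp
  next
    case 3
    then have "(a + b) \<bullet> (a + b) = 0"
      using k ab by (simp add: inner_add_left inner_add_right inner_commute)
    then show ?thesis by (simp add: eq_neg_iff_add_eq_0)
  qed (use k in simp)
qed

lemma inner_frame: "a \<in> frame \<Longrightarrow> b \<in> frame \<Longrightarrow> a \<bullet> b = (if a = b then q else 0)"
  using inner_short_roots[of a b] inner_frame_self by (auto simp: frame_def)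

lemma finite_frame: "finite frame"
  using finite_roots frame_root by (meson finite_subset subsetI)

text \<open>
  A root \<open>\<beta>\<close> not orthogonal to an element \<open>e\<close> of the frame is a multiple of the difference between
  \<open>e\<close> and its reflection in \<open>\<beta>\<close>, and both of these are short.  So lying in the span passes to
  non-orthogonal roots.
\<close>
lemma span_frame: "span frame = UNIV"
proof -
  define A where "A = {\<alpha>\<in>\<Phi>. \<alpha> \<in> span frame}"
  have short_span: "t \<in> span frame" if "short_root \<Phi> t" for t
    using short_root_frame[OF that] span_base[of t frame] span_neg[OF span_base[of "- t" frame]] by auto
  have "A = \<Phi>"
  proof (rule nonorthogonal_closed_eq_roots)
    show "A \<noteq> {}" using short_span[OF short] s_root by (auto simp: A_def)
    fix \<alpha> \<beta> assume \<alpha>: "\<alpha> \<in> A" and \<beta>: "\<beta> \<in> \<Phi>" "\<alpha> \<bullet> \<beta> \<noteq> 0"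
    have "\<exists>e\<in>frame. e \<bullet> \<beta> \<noteq> 0"
      using \<alpha> \<beta>(2) orthogonal_to_span[of \<alpha> frame \<beta>] by (auto simp: A_def orthogonal_def inner_commute)
    then obtain e where e: "e \<in> frame" "e \<bullet> \<beta> \<noteq> 0" by blast
    define c where "c = 2 * (e \<bullet> \<beta>) / (\<beta> \<bullet> \<beta>)"
    have "c \<noteq> 0" using e root_nonzero[OF \<beta>(1)] by (simp add: c_def)
    have "root_reflection \<beta> e \<in> span frame"
      using e short_root_reflection[OF \<beta>(1)] by (intro short_span) (simp add: frame_def)
    then have "e - c *\<^sub>R \<beta> \<in> span frame" by (simp add: root_reflection_def c_def)
    then have "e - (e - c *\<^sub>R \<beta>) \<in> span frame" by (rule span_diff[OF span_base[OF e(1)]])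
    then have "(1 / c) *\<^sub>R (e - (e - c *\<^sub>R \<beta>)) \<in> span frame" by (rule span_scale)
    then show "\<beta> \<in> A" using \<open>c \<noteq> 0\<close> \<beta> by (simp add: A_def)
  qed (auto simp: A_def)
  then have "\<Phi> \<subseteq> span frame" by (auto simp: A_def)
  then have "span \<Phi> \<subseteq> span frame" by (simp add: span_minimal)
  then show ?thesis using span_roots by auto
qed

lemma expansion: "x = (\<Sum>e\<in>frame. (x \<bullet> e / q) *\<^sub>R e)"
proof -
  define y where "y = x - (\<Sum>e\<in>frame. (x \<bullet> e / q) *\<^sub>R e)"
  have "y \<bullet> a = 0" if "a \<in> frame" for a
  proof -
    have "(\<Sum>e\<in>frame. (x \<bullet> e / q) *\<^sub>R e) \<bullet> a = (\<Sum>e\<in>frame. (x \<bullet> e / q) * (if e = a then q else 0))"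
      by (simp add: inner_sum_left inner_frame that cong: sum.cong)
    also have "\<dots> = (\<Sum>e\<in>frame. if e = a then x \<bullet> e else 0)"
      using q_pos by (intro sum.cong) auto
    also have "\<dots> = x \<bullet> a" using that finite_frame by simp
    finally show ?thesis by (simp add: y_def inner_diff_left)
  qed
  then have "orthogonal y y"
    using orthogonal_to_span[of y frame y] by (simp add: span_frame orthogonal_def)
  then show ?thesis by (simp add: orthogonal_def y_def)
qed

lemma inner_expansion: "x \<bullet> y = (\<Sum>e\<in>frame. (x \<bullet> e) * (y \<bullet> e)) / q"
proof -
  have "x \<bullet> y = (\<Sum>e\<in>frame. (x \<bullet> e / q) *\<^sub>R e) \<bullet> y" using expansion[of x] by simp
  also have "\<dots> = (\<Sum>e\<in>frame. (x \<bullet> e) * (y \<bullet> e)) / q"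
    unfolding inner_sum_left inner_scaleR_left sum_divide_distrib
    by (intro sum.cong) (auto simp: inner_commute)
  finally show ?thesis .
qed

text \<open>
  Let \<open>c\<^sub>e\<close> be the integral coordinates of \<open>\<beta>\<close> and \<open>N = \<Sum> c\<^sub>e\<^sup>2\<close>, so that \<open>\<beta> \<bullet> \<beta> = q N\<close>.  The Cartan number
  of \<open>e\<close> with respect to \<open>\<beta>\<close> is \<open>2 c\<^sub>e / N\<close>; its integrality gives \<open>N \<le> 2 \<bar>c\<^sub>e\<bar>\<close> whenever \<open>c\<^sub>e \<noteq> 0\<close>.
  A coordinate of absolute value at least \<open>2\<close> would exhaust \<open>N\<close> and make \<open>\<beta>\<close> a proper multiple
  of \<open>e\<close>.  So all coordinates are \<open>0\<close> or \<open>\<plusminus>1\<close>, and at most two of them are nonzero.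
\<close>
lemma root_cases:
  assumes \<beta>: "\<beta> \<in> \<Phi>"
  obtains (short) e \<sigma> where "e \<in> frame" "\<beta> = \<sigma> *\<^sub>R e" "\<sigma> = 1 \<or> \<sigma> = -1"
  | (long) a b \<sigma> \<tau> where "a \<in> frame" "b \<in> frame" "a \<noteq> b" "\<beta> = \<sigma> *\<^sub>R a + \<tau> *\<^sub>R b"
      "\<sigma> = 1 \<or> \<sigma> = -1" "\<tau> = 1 \<or> \<tau> = -1"
proof -
  have "\<exists>c::'a \<Rightarrow> int. \<forall>e\<in>frame. \<beta> \<bullet> e = q * of_int (c e)"
    using gram[OF \<beta> frame_root] by metis
  then obtain c :: "'a \<Rightarrow> int" where c: "\<And>e. e \<in> frame \<Longrightarrow> \<beta> \<bullet> e = q * of_int (c e)" by blast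
  define N where "N = (\<Sum>e\<in>frame. (c e)\<^sup>2)"
  have exp: "\<beta> = (\<Sum>e\<in>frame. of_int (c e) *\<^sub>R e)"
  proof -
    have "\<beta> = (\<Sum>e\<in>frame. (\<beta> \<bullet> e / q) *\<^sub>R e)" by (rule expansion)
    also have "\<dots> = (\<Sum>e\<in>frame. of_int (c e) *\<^sub>R e)"
      using q_pos by (intro sum.cong) (auto simp: c)
    finally show ?thesis .
  qed
  have norm: "\<beta> \<bullet> \<beta> = q * of_int N"
  proof -
    have "\<beta> \<bullet> \<beta> = (\<Sum>e\<in>frame. (\<beta> \<bullet> e) * (\<beta> \<bullet> e)) / q" by (rule inner_expansion)
    also have "(\<Sum>e\<in>frame. (\<beta> \<bullet> e) * (\<beta> \<bullet> e)) = (\<Sum>e\<in>frame. q * (q * of_int ((c e)\<^sup>2)))"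
      by (intro sum.cong) (auto simp: c power2_eq_square)
    finally show ?thesis using q_pos by (simp add: N_def flip: sum_distrib_left)
  qed
  have N_pos: "N > 0"
    using norm root_nonzero[OF \<beta>] q_pos by (metis inner_gt_zero_iff of_int_0_less_iff zero_less_mult_pos)
  have N_le: "N \<le> 2 * \<bar>c e\<bar>" if "e \<in> frame" "c e \<noteq> 0" for e
  proof -
    have "cartan_number e \<beta> \<in> \<int>" using cartan_number_Ints[OF \<beta> frame_root[OF that(1)]] .
    then obtain z :: int where "cartan_number e \<beta> = of_int z" by (elim Ints_cases)
    moreover have "cartan_number e \<beta> = 2 * of_int (c e) / of_int N"
      using q_pos by (simp add: cartan_number_def norm inner_commute c that)
    ultimately have "real_of_int (2 * c e) = of_int (z * N)" using N_pos by (simp add: field_simps)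
    then have "2 * c e = z * N" by (simp only: of_int_eq_iff)
    then have "N dvd 2 * c e" by simp
    then have "\<bar>N\<bar> \<le> \<bar>2 * c e\<bar>" using that by (intro dvd_imp_le_int) auto
    then show ?thesis by simp
  qed
  have c_le_1: "\<bar>c e\<bar> \<le> 1" if "e \<in> frame" for e
  proof (rule ccontr)
    assume "\<not> \<bar>c e\<bar> \<le> 1"
    then have ge2: "\<bar>c e\<bar> \<ge> 2" by simp
    have "N \<le> 2 * \<bar>c e\<bar>" using ge2 that by (intro N_le) auto
    also have "\<dots> \<le> \<bar>c e\<bar> * \<bar>c e\<bar>" using ge2 by (intro mult_right_mono) auto
    finally have "N \<le> (c e)\<^sup>2" by (simp add: power2_eq_square)
    moreover have "N = (c e)\<^sup>2 + (\<Sum>a\<in>frame - {e}. (c a)\<^sup>2)"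
      using that finite_frame by (simp add: N_def sum.remove)
    moreover have "(\<Sum>a\<in>frame - {e}. (c a)\<^sup>2) \<ge> 0" by (simp add: sum_nonneg)
    ultimately have "(\<Sum>a\<in>frame - {e}. (c a)\<^sup>2) = 0" by linarith
    then have 0: "\<forall>a\<in>frame - {e}. c a = 0" using finite_frame by (simp add: sum_nonneg_eq_0_iff)
    have "\<beta> = of_int (c e) *\<^sub>R e + (\<Sum>a\<in>frame - {e}. of_int (c a) *\<^sub>R a)"
      using that finite_frame by (subst exp) (simp add: sum.remove)
    then have "\<beta> = of_int (c e) *\<^sub>R e" using 0 by simp
    then have "real_of_int (c e) = 1 \<or> real_of_int (c e) = -1"
      using reduced[OF frame_root[OF that]] \<beta> by metis
    then show False using ge2 by linarith
  qed
  define S where "S = {e\<in>frame. c e \<noteq> 0}"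
  have sgn: "real_of_int (c e) = 1 \<or> real_of_int (c e) = -1" if "e \<in> S" for e
    using that c_le_1[of e] by (auto simp: S_def)
  have "N = (\<Sum>e\<in>S. 1)"
    unfolding N_def
  proof (rule sum.mono_neutral_cong_right)
    show "(c e)\<^sup>2 = 1" if "e \<in> S" for e
    proof -
      have "c e = 1 \<or> c e = -1" using sgn[OF that] by linarith
      then show ?thesis by auto
    qed
  qed (use finite_frame in \<open>auto simp: S_def\<close>)
  then have card: "N = int (card S)" by simp
  have \<beta>S: "\<beta> = (\<Sum>e\<in>S. of_int (c e) *\<^sub>R e)"
    by (subst exp, rule sum.mono_neutral_right) (use finite_frame in \<open>auto simp: S_def\<close>)
  have "card S \<noteq> 0" using card N_pos by simp
  then obtain e where "e \<in> S" by fastforce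
  then have "N \<le> 2" using N_le[of e] c_le_1[of e] by (auto simp: S_def)
  with card N_pos consider "card S = 1" | "card S = 2" by linarith
  then show ?thesis
  proof cases
    case 1
    then obtain e where "S = {e}" by (auto simp: card_1_singleton_iff)
    then show ?thesis using \<beta>S sgn[of e] by (intro local.short[of e "of_int (c e)"]) (auto simp: S_def)
  next
    case 2
    then obtain a b where ab: "S = {a, b}" "a \<noteq> b" by (auto simp: card_2_iff)
    have "a \<in> frame" "b \<in> frame" using ab by (auto simp: S_def)
    then show ?thesis
      using \<beta>S sgn[of a] sgn[of b] ab by (intro long[of a b "of_int (c a)" "of_int (c b)"]) auto
  qed
qed

text \<open>Reflecting in \<open>b\<close> changes the sign of \<open>\<tau>\<close>.\<close>
lemma root_diff_if_combination:
  assumes ab: "a \<in> frame" "b \<in> frame" "a \<noteq> b" and root: "\<sigma> *\<^sub>R a + \<tau> *\<^sub>R b \<in> \<Phi>"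
    and sgn: "\<sigma> = 1 \<or> \<sigma> = -1" "\<tau> = 1 \<or> \<tau> = -1"
  shows "a - b \<in> \<Phi>"
proof -
  have "root_reflection b (\<sigma> *\<^sub>R a + \<tau> *\<^sub>R b) = \<sigma> *\<^sub>R a - \<tau> *\<^sub>R b"
    using ab q_pos by (simp add: root_reflection_def inner_add_left inner_frame flip: scaleR_left_diff_distrib)
  then have "\<sigma> *\<^sub>R a - \<tau> *\<^sub>R b \<in> \<Phi>"
    using reflection_root[OF frame_root[OF ab(2)] root] by simp
  with root sgn neg_root[OF root] neg_root[OF this] show ?thesis by auto
qed

lemma root_diff_trans:
  assumes "a \<in> frame" "b \<in> frame" "c \<in> frame" "a \<noteq> b" "b \<noteq> c" "a \<noteq> c" "a - b \<in> \<Phi>" "b - c \<in> \<Phi>"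
  shows "a - c \<in> \<Phi>"
proof -
  have "root_reflection (b - c) (a - b) = a - c"
    using assms q_pos by (simp add: root_reflection_def inner_diff_left inner_diff_right inner_frame)
  then show ?thesis using reflection_root[OF assms(8,7)] by simp
qed

text \<open>
  Being equal or having a root as difference is an equivalence relation on the frame.  A root
  involves frame vectors of one class only, so the roots supported on the class of \<open>a\<close> are
  closed under non-orthogonality, and by irreducibility there is just one class.
\<close>
lemma root_diff:
  assumes a: "a \<in> frame" and b: "b \<in> frame" and "a \<noteq> b"
  shows "a - b \<in> \<Phi>"
proof -
  define C where "C = {e\<in>frame. e = a \<or> a - e \<in> \<Phi>}"
  define A where "A = {\<beta>\<in>\<Phi>. \<forall>e\<in>frame - C. \<beta> \<bullet> e = 0}"
  have C_closed: "y \<in> C" if "x \<in> C" "y \<in> frame" "x \<noteq> y" "x - y \<in> \<Phi>" for x y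
    using that root_diff_trans[of a x y] a by (auto simp: C_def)
  have "A = \<Phi>"
  proof (rule nonorthogonal_closed_eq_roots)
    have "a \<in> A" using a frame_root by (auto simp: A_def C_def inner_frame)
    then show "A \<noteq> {}" by blast
    fix \<alpha> \<beta> assume \<alpha>: "\<alpha> \<in> A" and \<beta>: "\<beta> \<in> \<Phi>" "\<alpha> \<bullet> \<beta> \<noteq> 0"
    have inC: "e \<in> C" if "e \<in> frame" "\<alpha> \<bullet> e \<noteq> 0" for e
      using \<alpha> that by (auto simp: A_def)
    from \<beta>(1) show "\<beta> \<in> A"
    proof (cases rule: root_cases)
      case (short e \<sigma>)
      then have "e \<in> C" using \<beta>(2) by (intro inC) auto
      then show ?thesis using short \<beta>(1) by (auto simp: A_def inner_frame)
    next
      case (long x y \<sigma> \<tau>)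
      have xy: "x - y \<in> \<Phi>"
        using root_diff_if_combination[of x y \<sigma> \<tau>] long \<beta>(1) by simp
      then have yx: "y - x \<in> \<Phi>" using neg_root[OF xy] by simp
      have "\<alpha> \<bullet> x \<noteq> 0 \<or> \<alpha> \<bullet> y \<noteq> 0" using \<beta>(2) long by (auto simp: inner_add_right)
      then have "x \<in> C \<or> y \<in> C" using inC long by blast
      then have "x \<in> C" "y \<in> C" using C_closed[of x y] C_closed[of y x] xy yx long by auto
      then show ?thesis using long \<beta>(1) by (auto simp: A_def inner_add_left inner_frame)
    qed
  qed (auto simp: A_def)
  then have "b \<in> A" using frame_root[OF b] by simp
  moreover have "b \<bullet> b \<noteq> 0" using inner_frame_self[OF b] q_pos by simp
  ultimately have "b \<in> C" using b unfolding A_def by blast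
  then show ?thesis using \<open>a \<noteq> b\<close> by (simp add: C_def)
qed

definition nat_height :: "'a \<Rightarrow> nat" where
  "nat_height e = nat \<lfloor>height e\<rfloor>"

lemma height_frame:
  assumes "e \<in> frame"
  shows "height e = real (nat_height e)" and "nat_height e \<ge> 1"
proof -
  obtain k :: int where k: "height e = of_int k" using height_root[OF frame_root[OF assms]] by metis
  have "height e > 0" using assms by (simp add: frame_def)
  with k show "height e = real (nat_height e)" "nat_height e \<ge> 1" by (auto simp: nat_height_def)
qed

text \<open>The difference of two elements of the frame is a root, and roots have nonzero height.\<close>
lemma inj_on_nat_height: "inj_on nat_height frame"
proof (rule inj_onI, rule ccontr)
  fix a b assume ab: "a \<in> frame" "b \<in> frame" "nat_height a = nat_height b" "a \<noteq> b"
  obtain k :: int where "k \<noteq> 0" "height (a - b) = of_int k"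
    using height_root[OF root_diff[OF ab(1,2,4)]] .
  then show False using ab by (simp add: height_frame)
qed

text \<open>
  Simple roots have height \<open>1\<close> and elements of the frame have height at least \<open>1\<close>, so
  \<open>\<plusminus>a \<plusminus> b\<close> is simple only with opposite signs and consecutive heights.
\<close>
lemma simple_root_cases:
  assumes \<delta>: "\<delta> \<in> \<Delta>"
  obtains "\<delta> \<in> frame" "nat_height \<delta> = 1"
  | a b where "a \<in> frame" "b \<in> frame" "\<delta> = a - b" "nat_height a = nat_height b + 1"
  using simple_root[OF \<delta>]
proof (cases rule: root_cases)
  case (short e \<sigma>)
  then have "\<sigma> * real (nat_height e) = 1" using height_simple[OF \<delta>] by (simp add: height_frame)
  then have "\<delta> = e" "nat_height e = 1" using short by auto
  then show ?thesis using short that(1) by simp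
next
  case (long a b \<sigma> \<tau>)
  then have height: "\<sigma> * real (nat_height a) + \<tau> * real (nat_height b) = 1"
    using height_simple[OF \<delta>] by (simp add: height_frame)
  have ge: "nat_height a \<ge> 1" "nat_height b \<ge> 1" using height_frame long by auto
  have "\<sigma> = 1 \<and> \<tau> = -1 \<and> nat_height a = nat_height b + 1 \<or> \<sigma> = -1 \<and> \<tau> = 1 \<and> nat_height b = nat_height a + 1"
    by (insert long(5,6) height ge; elim disjE; simp; linarith)
  then consider "\<sigma> = 1" "\<tau> = -1" "nat_height a = nat_height b + 1" | "\<sigma> = -1" "\<tau> = 1" "nat_height b = nat_height a + 1"
    by blast
  then show ?thesis
  proof cases
    case 1
    then show ?thesis using long that(2)[of a b] by simp
  next
    case 2
    then show ?thesis using long that(2)[of b a] by simp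
  qed
qed

lemma card_frame: "card frame = DIM('a)" and card_simple: "card \<Delta> = DIM('a)"
proof -
  have "independent frame"
  proof (rule pairwise_orthogonal_independent)
    show "pairwise orthogonal frame" by (auto simp: pairwise_def orthogonal_def inner_frame)
    show "0 \<notin> frame" using frame_root root_nonzero by blast
  qed
  then show "card frame = DIM('a)"
    using basis_card_eq_dim[of frame UNIV] span_frame by simp
  have "\<Phi> \<subseteq> span \<Delta>"
  proof
    fix \<beta> assume "\<beta> \<in> \<Phi>"
    then obtain c :: "'a \<Rightarrow> int" where "\<beta> = (\<Sum>\<delta>\<in>\<Delta>. of_int (c \<delta>) *\<^sub>R \<delta>)"
      using simple unfolding simple_roots_def by metis
    then show "\<beta> \<in> span \<Delta>" by (simp add: span_sum span_scale span_base)
  qed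
  then have "span \<Phi> \<subseteq> span \<Delta>" by (simp add: span_minimal)
  then have "span \<Delta> = UNIV" using span_roots by auto
  moreover have "independent \<Delta>" using simple by (simp add: simple_roots_def)
  ultimately show "card \<Delta> = DIM('a)"
    using basis_card_eq_dim[of \<Delta> UNIV] by simp
qed

text \<open>
  The value \<open>0\<close> off the heights of the frame lets \<open>frame_at (k + 1) - frame_at k\<close> cover the
  short simple root as well, at \<open>k = 0\<close>.
\<close>
definition frame_at :: "nat \<Rightarrow> 'a" where
  "frame_at k = (if k \<in> nat_height ` frame then the_inv_into frame nat_height k else 0)"

lemma frame_at_nat_height: "e \<in> frame \<Longrightarrow> frame_at (nat_height e) = e"
  by (simp add: frame_at_def the_inv_into_f_f[OF inj_on_nat_height])

lemma frame_at_0: "frame_at 0 = 0"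
  using height_frame(2) by (force simp: frame_at_def)

text \<open>
  Each simple root is determined by the element of the frame of larger height occurring in it,
  and only elements of height \<open>1\<close> or with a predecessor in height can occur this way.  There are
  as many simple roots as elements of the frame, so every element qualifies, and the set of
  heights has no gaps.
\<close>
lemma simple_roots_eq_frame_differences:
  shows "bij_betw (\<lambda>e. e - frame_at (nat_height e - 1)) frame \<Delta>" and "nat_height ` frame = {1..DIM('a)}"
proof -
  let ?h = "\<lambda>e. e - frame_at (nat_height e - 1)"
  \<comment> \<open>The elements of the frame that can be the larger part of a simple root.\<close>
  define frame' where "frame' = {e\<in>frame. nat_height e = 1 \<or> nat_height e - 1 \<in> nat_height ` frame}"
  have "\<Delta> \<subseteq> ?h ` frame'"
  proof
    fix \<delta> assume "\<delta> \<in> \<Delta>"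
    then show "\<delta> \<in> ?h ` frame'"
    proof (cases rule: simple_root_cases)
      case 1
      then show ?thesis by (intro image_eqI[of _ _ \<delta>]) (auto simp: frame'_def frame_at_0)
    next
      case (2 a b)
      then show ?thesis by (intro image_eqI[of _ _ a]) (auto simp: frame'_def frame_at_nat_height)
    qed
  qed
  moreover have fin: "finite frame'" "frame' \<subseteq> frame" using finite_frame by (auto simp: frame'_def)
  ultimately have "card \<Delta> \<le> card (?h ` frame')" by (intro card_mono) auto
  moreover have "card (?h ` frame') \<le> card frame'" using fin by (intro card_image_le)
  moreover have "card frame' \<le> card frame" using fin finite_frame by (intro card_mono)
  ultimately have card: "card (?h ` frame') = card \<Delta>" "card frame' = card (?h ` frame')" "card frame' = card frame"
    using card_frame card_simple by auto
  have frame': "frame' = frame" using card_subset_eq[OF finite_frame fin(2) card(3)] .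
  have "?h ` frame' = \<Delta>"
    using card_subset_eq[OF finite_imageI[OF fin(1)] \<open>\<Delta> \<subseteq> ?h ` frame'\<close>] card by simp
  moreover have "inj_on ?h frame'" using card(2) fin(1) by (intro eq_card_imp_inj_on) auto
  ultimately show "bij_betw ?h frame \<Delta>" by (simp add: bij_betw_def frame')
  have down: "k - 1 \<in> nat_height ` frame" if "k \<in> nat_height ` frame" "k \<noteq> 1" for k
    using that frame' by (auto simp: frame'_def)
  have "{1..k} \<subseteq> nat_height ` frame" if "k \<in> nat_height ` frame" for k
    using that
  proof (induction k)
    case (Suc k)
    show ?case
    proof (cases "k = 0")
      case False
      then have "{1..k} \<subseteq> nat_height ` frame" using down[OF Suc.prems] Suc.IH by simp
      then show ?thesis using Suc.prems by (auto simp: atLeastAtMostSuc_conv)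
    qed (use Suc.prems in auto)
  qed auto
  moreover have card_heights: "card (nat_height ` frame) = DIM('a)" using card_image[OF inj_on_nat_height] card_frame by simp
  ultimately have le: "k \<le> DIM('a)" if "k \<in> nat_height ` frame" for k
    using card_mono[of "nat_height ` frame" "{1..k}"] finite_frame that by simp
  have "nat_height ` frame \<subseteq> {1..DIM('a)}" using height_frame(2) le by auto
  then show "nat_height ` frame = {1..DIM('a)}"
    using card_subset_eq[of "{1..DIM('a)}" "nat_height ` frame"] card_heights by simp
qed

lemma inner_frame_at:
  assumes "i \<le> DIM('a)" "j \<le> DIM('a)"
  shows "frame_at i \<bullet> frame_at j = (if i = j \<and> i \<noteq> 0 then q else 0)"
proof -
  have frame: "\<exists>e\<in>frame. frame_at k = e \<and> nat_height e = k" if "k \<le> DIM('a)" "k \<noteq> 0" for k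
  proof -
    have "k \<in> nat_height ` frame" using simple_roots_eq_frame_differences(2) that by auto
    then show ?thesis using frame_at_nat_height by auto
  qed
  show ?thesis
  proof (cases "i = 0 \<or> j = 0")
    case False
    then show ?thesis using frame[OF assms(1)] frame[OF assms(2)] by (auto simp: inner_frame)
  qed (auto simp: frame_at_0)
qed

lemma type_B_simple_roots: "type_B (DIM('a)) \<Delta>"
proof -
  let ?n = "DIM('a)"
  let ?g = "(\<lambda>e. e - frame_at (nat_height e - 1)) \<circ> (frame_at \<circ> (\<lambda>i. ?n + 1 - i))"
  \<comment> \<open>The numbering of type \<open>B\<^sub>n\<close> runs by decreasing height, ending with the short simple root.\<close>
  define a where "a i = frame_at (?n + 1 - i) - frame_at (?n - i)" for i
  have "bij_betw (\<lambda>i. ?n + 1 - i) {1..?n} {1..?n}"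
    by (rule bij_betwI[of _ _ _ "\<lambda>i. ?n + 1 - i"]) auto
  moreover have "bij_betw frame_at {1..?n} frame"
    unfolding simple_roots_eq_frame_differences(2)[symmetric]
    by (rule bij_betw_imageI) (auto simp: inj_on_def frame_at_nat_height image_image)
  moreover note simple_roots_eq_frame_differences(1)
  ultimately have bij: "bij_betw ?g {1..?n} \<Delta>"
    by (blast intro: bij_betw_trans)
  have g: "?g i = a i" if "i \<in> {1..?n}" for i
  proof -
    have "?n + 1 - i \<in> nat_height ` frame" unfolding simple_roots_eq_frame_differences(2) using that by auto
    then have "nat_height (frame_at (?n + 1 - i)) = ?n + 1 - i" using frame_at_nat_height by auto
    then show ?thesis using that by (simp add: a_def)
  qed
  have "bij_betw ?g {1..?n} \<Delta> \<longleftrightarrow> bij_betw a {1..?n} \<Delta>"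
    by (rule bij_betw_cong) (fact g)
  with bij have "bij_betw a {1..?n} \<Delta>" by blast
  moreover have "cartan_number (a i) (a j) =
           (if i = j then 2
            else if i + 1 = ?n \<and> j = ?n then -2
            else if i + 1 = j \<or> j + 1 = i then -1
            else 0)" if ij: "i \<in> {1..?n}" "j \<in> {1..?n}" for i j
  proof -
    have "a i \<bullet> a j = (if i = j then (if i = ?n then q else 2 * q)
        else if i + 1 = j \<or> j + 1 = i then - q else 0)" if "i \<in> {1..?n}" "j \<in> {1..?n}" for i j
    proof -
      define k m where "k = ?n - i" and "m = ?n - j"
      then have km: "?n + 1 - i = Suc k" "?n - i = k" "?n + 1 - j = Suc m" "?n - j = m"
        using that by (simp_all add: Suc_diff_le)
      have "k < ?n" "m < ?n" using that by (simp_all add: k_def m_def)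
      then have "a i \<bullet> a j = (if k = m then q else 0) - (if Suc k = m then q else 0)
          - (if k = Suc m then q else 0) + (if k = m \<and> k \<noteq> 0 then q else 0)"
        unfolding a_def km by (simp add: inner_diff_left inner_diff_right inner_frame_at)
      moreover have "k = m \<longleftrightarrow> i = j" "Suc k = m \<longleftrightarrow> j + 1 = i" "k = Suc m \<longleftrightarrow> i + 1 = j" "k = 0 \<longleftrightarrow> i = ?n"
        using that unfolding k_def m_def atLeastAtMost_iff by linarith+
      ultimately show ?thesis by simp
    qed
    from this[OF ij] this[OF ij(2,2)] show ?thesis
      using ij q_pos by (auto simp: cartan_number_def)
  qed
  ultimately show ?thesis unfolding type_B_def by (auto simp: Suc_le_eq)
qed

end

section \<open>Parity of the normalized form on the lattices\<close>

context irreducible_roots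
begin

text \<open>
  On simple roots and fundamental weights the form has the values \<open>0\<close> and \<open>B \<delta> \<delta> / 2\<close>.
\<close>
lemma form_weight_lattice:
  assumes B: "normalized_invariant_form \<Phi> B" and simple: "simple_roots \<Phi> \<Delta>"
    and \<nu>: "\<nu> \<in> root_lattice \<Phi>" and \<mu>: "\<mu> \<in> weight_lattice B \<Delta>"
  shows "\<exists>k::int. B \<nu> \<mu> = of_int k"
proof -
  have bil: "bilinear B" and sym: "\<And>x y. B x y = B y x"
    using B by (auto simp: normalized_invariant_form_def)
  have "\<exists>k::int. B \<nu> \<mu> = 1 * of_int k"
  proof (rule bilinear_group_closure_multiple[OF bil])
    show "\<nu> \<in> group_closure \<Delta>" using \<nu> root_lattice_eq_group_closure_simple[OF simple] by simp
    show "\<mu> \<in> group_closure {w. \<exists>\<alpha>\<in>\<Delta>. fundamental_weight B \<Delta> \<alpha> w}"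
      using \<mu> by (simp add: weight_lattice_def)
    fix \<delta> w assume \<delta>: "\<delta> \<in> \<Delta>" and "w \<in> {w. \<exists>\<alpha>\<in>\<Delta>. fundamental_weight B \<Delta> \<alpha> w}"
    then obtain \<alpha> where "fundamental_weight B \<Delta> \<alpha> w" by blast
    then have "B \<delta> w = (if \<alpha> = \<delta> then B \<delta> \<delta> / 2 else 0)"
      using \<delta> sym[of \<delta> w] by (simp add: fundamental_weight_def)
    moreover have "B \<delta> \<delta> / 2 \<in> \<int>"
      using half_form_root_Ints[OF B] \<delta> simple by (auto simp: simple_roots_def)
    ultimately have "B \<delta> w \<in> \<int>" by simp
    then show "\<exists>k::int. B \<delta> w = 1 * of_int k" by (auto elim: Ints_cases)
  qed
  then show ?thesis by simp
qed

text \<open>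
  With \<open>d\<^sub>j = B \<alpha>\<^sub>j \<alpha>\<^sub>j / 2\<close>, the Gram matrix of the simple roots is the Cartan matrix with column
  \<open>j\<close> scaled by \<open>d\<^sub>j\<close>.  By symmetry of \<open>B\<close>, \<open>d\<^sub>j\<close> is even for \<open>j < n\<close>, and the off-diagonal
  entries of the last column are \<open>0\<close> and \<open>- 2 d\<^sub>n\<close>.
\<close>
lemma type_B_form_even:
  assumes B: "normalized_invariant_form \<Phi> B" and simple: "simple_roots \<Phi> \<Delta>"
    and type: "type_B n \<Delta>"
    and \<mu>\<nu>: "\<mu> \<in> root_lattice \<Phi>" "\<nu> \<in> root_lattice \<Phi>"
  shows "\<exists>k::int. B \<mu> \<nu> = 2 * of_int k"
proof -
  have bil: "bilinear B" and sym: "\<And>x y. B x y = B y x"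
    using B by (auto simp: normalized_invariant_form_def)
  obtain a where bij: "bij_betw a {1..n} \<Delta>" and n: "n \<ge> 1"
    and cartan: "\<And>i j. i \<in> {1..n} \<Longrightarrow> j \<in> {1..n} \<Longrightarrow> cartan_number (a i) (a j) =
           (if i = j then 2
            else if i + 1 = n \<and> j = n then -2
            else if i + 1 = j \<or> j + 1 = i then -1
            else 0)"
    using type unfolding type_B_def by blast
  have root: "a i \<in> \<Phi>" if "i \<in> {1..n}" for i
    using bij_betwE[OF bij] that simple by (auto simp: simple_roots_def)
  define d where "d i = B (a i) (a i) / 2" for i
  have form: "B (a i) (a j) = cartan_number (a i) (a j) * d j" if "i \<in> {1..n}" "j \<in> {1..n}" for i j
    unfolding d_def using form_root_root[OF B root[OF that(2)]] .
  have d: "\<exists>k::int. d i = of_int k" if "i \<in> {1..n}" for i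
    using half_form_root_Ints[OF B root[OF that]] unfolding d_def by (elim Ints_cases) blast
  have even_d: "\<exists>k::int. d i = 2 * of_int k" if "1 \<le> i" "i \<le> n - 1" for i
    using that(2)
  proof (induction rule: inc_induct)
    case base
    have m: "n - 1 \<in> {1..n}" "n \<in> {1..n}" "n - 1 \<noteq> n" "n - 1 + 1 = n" using that by auto
    have "- 2 * d n = - d (n - 1)"
      using form[OF m(1,2)] form[OF m(2,1)] sym[of "a n"] cartan[OF m(1,2)] cartan[OF m(2,1)] m by simp
    moreover obtain k :: int where "d n = of_int k" using d[OF m(2)] by blast
    ultimately show ?case by (intro exI[of _ k]) simp
  next
    case (step j)
    have m: "j \<in> {1..n}" "Suc j \<in> {1..n}" "Suc j \<noteq> n" "j \<noteq> n" using that step by auto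
    have "d j = d (Suc j)"
      using form[OF m(1,2)] form[OF m(2,1)] sym[of "a j"] cartan[OF m(1,2)] cartan[OF m(2,1)] m by simp
    then show ?case using step.IH by simp
  qed
  have gen: "\<exists>k::int. B \<delta> \<epsilon> = 2 * of_int k" if \<delta>\<epsilon>: "\<delta> \<in> \<Delta>" "\<epsilon> \<in> \<Delta>" for \<delta> \<epsilon>
  proof -
    obtain i j where ij: "i \<in> {1..n}" "j \<in> {1..n}" "\<delta> = a i" "\<epsilon> = a j"
      using \<delta>\<epsilon> bij unfolding bij_betw_def by blast
    obtain k :: int where k: "d j = of_int k" using d[OF ij(2)] by blast
    consider "i = j" | "i \<noteq> j" "i + 1 = n" "j = n"
      | "i \<noteq> j" "j \<noteq> n" | "i \<noteq> j" "j = n" "i + 1 \<noteq> n" by blast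
    then show ?thesis
    proof cases
      case 1
      then show ?thesis unfolding ij(3,4) form[OF ij(1,2)] cartan[OF ij(1,2)] k by auto
    next
      case 2
      then show ?thesis unfolding ij(3,4) form[OF ij(1,2)] cartan[OF ij(1,2)] k
        by (intro exI[of _ "- k"]) simp
    next
      case 3
      then have "1 \<le> j" "j \<le> n - 1" using ij(2) by auto
      then obtain m :: int where m: "d j = 2 * of_int m" using even_d by blast
      have "B \<delta> \<epsilon> = 0 \<or> B \<delta> \<epsilon> = - (2 * of_int m)"
        unfolding ij(3,4) form[OF ij(1,2)] cartan[OF ij(1,2)] m using 3 by simp
      then show ?thesis by (metis mult_minus_right mult_zero_right of_int_0 of_int_minus)
    next
      case 4
      then have "B \<delta> \<epsilon> = 0"
        unfolding ij(3,4) form[OF ij(1,2)] cartan[OF ij(1,2)] using ij(1) by auto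
      then show ?thesis by (intro exI[of _ 0]) simp
    qed
  qed
  show ?thesis
    by (rule bilinear_group_closure_multiple[OF bil gen])
      (use \<mu>\<nu> root_lattice_eq_group_closure_simple[OF simple] in auto)
qed

text \<open>
  For the equality of the lattices: a vector of \<open>\<Lambda>\<close> has integral coordinates with respect to the
  frame, and the frame consists of roots.
\<close>
lemma form_even_imp_type_B:
  assumes B: "normalized_invariant_form \<Phi> B" and simple: "simple_roots \<Phi> \<Delta>"
    and sub: "root_lattice \<Phi> \<subseteq> \<Lambda>"
    and even: "\<And>\<alpha> \<mu>. \<alpha> \<in> \<Phi> \<Longrightarrow> \<mu> \<in> \<Lambda> \<Longrightarrow> \<exists>k::int. B \<alpha> \<mu> = 2 * of_int k"
  shows "type_B (DIM('a)) \<Delta>" and "\<Lambda> = root_lattice \<Phi>"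
proof -
  have inner: "\<exists>k::int. \<alpha> \<bullet> \<mu> = q * of_int k" if "\<alpha> \<in> \<Phi>" "\<mu> \<in> \<Lambda>" for \<alpha> \<mu>
    using even[OF that] q_pos by (auto simp: normalized_invariant_form_eq[OF B] field_simps)
  have root_mem: "\<alpha> \<in> root_lattice \<Phi>" if "\<alpha> \<in> \<Phi>" for \<alpha>
    using that by (simp add: root_lattice_def group_closure.base)
  interpret integral_roots \<Phi> s \<Delta>
  proof unfold_locales
    show "\<exists>k::int. \<alpha> \<bullet> \<beta> = q * of_int k" if "\<alpha> \<in> \<Phi>" "\<beta> \<in> \<Phi>" for \<alpha> \<beta>
      using inner[OF that(1)] root_mem[OF that(2)] sub by blast
  qed (fact simple)
  show "type_B (DIM('a)) \<Delta>" by (rule type_B_simple_roots)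
  have "\<mu> \<in> root_lattice \<Phi>" if \<mu>: "\<mu> \<in> \<Lambda>" for \<mu>
  proof -
    have "\<exists>c::'a \<Rightarrow> int. \<forall>e\<in>frame. e \<bullet> \<mu> = q * of_int (c e)"
      using inner[OF frame_root \<mu>] by metis
    then obtain c :: "'a \<Rightarrow> int" where c: "\<And>e. e \<in> frame \<Longrightarrow> e \<bullet> \<mu> = q * of_int (c e)" by blast
    have "\<mu> = (\<Sum>e\<in>frame. (\<mu> \<bullet> e / q) *\<^sub>R e)" by (rule expansion)
    also have "\<dots> = (\<Sum>e\<in>frame. of_int (c e) *\<^sub>R e)"
      using q_pos c by (intro sum.cong) (auto simp: inner_commute)
    also have "\<dots> \<in> root_lattice \<Phi>"
      unfolding root_lattice_def using frame_root by (intro group_closure_sum_of_int_scaleR) auto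
    finally show ?thesis .
  qed
  with sub show "\<Lambda> = root_lattice \<Phi>" by auto
qed

end

section \<open>Parity of the order of the quotient by the centralizer\<close>

theorem lemma5p12:
  fixes \<Phi> \<Delta> \<Lambda> :: "'a::euclidean_space set"
    and B :: "'a \<Rightarrow> 'a \<Rightarrow> real"
    and l :: nat
  assumes "irreducible_root_system \<Phi>"
    and "simple_roots \<Phi> \<Delta>"
    and "normalized_invariant_form \<Phi> B"
    and "l \<ge> 1"
    and "subgroup \<Lambda> (additive_group UNIV)"
    and "root_lattice \<Phi> \<subseteq> \<Lambda>"
    and "\<Lambda> \<subseteq> weight_lattice B \<Delta>"
  shows "odd (order (additive_group \<Lambda> Mod Cent B l (root_lattice \<Phi>) \<Lambda>)) \<longleftrightarrow>
         odd (order (additive_group \<Lambda> Mod root_lattice \<Phi>)) \<and>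
         (odd l \<or> (l mod 4 = 2 \<and> (\<exists>n. type_B n \<Delta>) \<and> \<Lambda> = root_lattice \<Phi>))"
proof -
  obtain s where s: "short_root \<Phi> s" using ex_short_root[OF assms(1)] .
  interpret irreducible_roots \<Phi> s by unfold_locales (fact assms(1) s)+
  let ?R = "root_lattice \<Phi>" and ?K = "Cent B l (root_lattice \<Phi>) \<Lambda>"
  have bil: "bilinear B" and Bs: "B s s = 2"
    using assms(3) s by (auto simp: normalized_invariant_form_def)
  have Bscale: "B (c *\<^sub>R x) y = c * B x y" for c x y
    by (simp add: bilinear_lmul[OF bil])
  have Ints: "\<exists>k::int. B \<nu> \<mu> = of_int k" if "\<nu> \<in> ?R" "\<mu> \<in> \<Lambda>" for \<nu> \<mu>
    using form_weight_lattice[OF assms(3,2)] that assms(7) by blast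
  have R_scale: "real k *\<^sub>R x \<in> ?R" if "x \<in> ?R" for k :: nat and x
    using group_closure_of_int_scaleR[of x \<Phi> "int k"] that by (simp add: root_lattice_def)
  have R_subgroup: "subgroup ?R (additive_group UNIV)"
    unfolding root_lattice_def by (rule subgroup_additive_groupI) (auto intro: group_closure.diff)
  have K_diff: "x - y \<in> ?K" if "x \<in> ?K" "y \<in> ?K" for x y
  proof -
    have "\<exists>k::int. B (x - y) \<mu> = real l * of_int k" if \<mu>: "\<mu> \<in> \<Lambda>" for \<mu>
    proof -
      obtain i j :: int where "B x \<mu> = real l * of_int i" "B y \<mu> = real l * of_int j"
        using \<open>x \<in> ?K\<close> \<open>y \<in> ?K\<close> \<mu> unfolding Cent_def by blast
      then have "B (x - y) \<mu> = real l * of_int (i - j)"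
        by (simp add: bilinear_lsub[OF bil] algebra_simps)
      then show ?thesis by blast
    qed
    then show ?thesis
      using that by (auto simp: Cent_def root_lattice_def intro: group_closure.diff)
  qed
  have "0 \<in> ?K"
    by (auto simp: Cent_def root_lattice_def bilinear_lzero[OF bil] intro!: exI[of _ 0])
  then have K_subgroup: "subgroup ?K (additive_group UNIV)"
    using K_diff by (rule subgroup_additive_groupI)
  have K_R: "?K \<subseteq> ?R" by (auto simp: Cent_def)
  have lR: "real l *\<^sub>R x \<in> ?K" if "x \<in> ?R" for x
    using Ints[OF that] R_scale[OF that] by (fastforce simp: Cent_def Bscale)
  note quotient_K = odd_order_additive_quotient_iff[OF assms(5) K_subgroup]
  note quotient_R = odd_order_additive_quotient_iff[OF assms(5) R_subgroup assms(6)]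
  have K_\<Lambda>: "?K \<subseteq> \<Lambda>" using K_R assms(6) by blast
  show ?thesis
    unfolding quotient_K[OF K_\<Lambda>] quotient_R
  proof (intro iffI conjI; (elim conjE exE)?)
    fix F assume "finite F" "\<forall>x\<in>\<Lambda>. \<exists>y\<in>F. x - y \<in> ?K"
    then show "\<exists>F. finite F \<and> (\<forall>x\<in>\<Lambda>. \<exists>y\<in>F. x - y \<in> ?R)" using K_R by blast
  next
    fix k :: nat assume "odd k" "\<forall>x\<in>\<Lambda>. real k *\<^sub>R x \<in> ?K"
    then show "\<exists>k::nat. odd k \<and> (\<forall>x\<in>\<Lambda>. real k *\<^sub>R x \<in> ?R)" using K_R by blast
  next
    fix k :: nat assume k: "odd k" "\<forall>x\<in>\<Lambda>. real k *\<^sub>R x \<in> ?K"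
    \<comment> \<open>An odd exponent of the quotient makes \<open>l\<close> divide all values of the form up to an odd factor.\<close>
    have dvd: "int l dvd int k * b" if x: "x \<in> ?R" and \<mu>: "\<mu> \<in> \<Lambda>" and b: "B x \<mu> = of_int b" for x \<mu> b
    proof -
      have "real k *\<^sub>R x \<in> ?K" using k(2) x assms(6) by blast
      then obtain j :: int where "real k * B x \<mu> = real l * of_int j"
        using \<mu> unfolding Cent_def mem_Collect_eq Bscale by blast
      then have "real_of_int (int k * b) = of_int (int l * j)" using b by simp
      then show ?thesis by (simp only: of_int_eq_iff) simp
    qed
    show "odd l \<or> (l mod 4 = 2 \<and> (\<exists>n. type_B n \<Delta>) \<and> \<Lambda> = ?R)"
    proof (cases "odd l")
      case False
      have sR: "s \<in> ?R" using s_root by (simp add: root_lattice_def group_closure.base)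
      have "int l dvd int k * 2" using dvd[of s s 2] sR assms(6) Bs by auto
      then have "l dvd k * 2" by (metis int_dvd_int_iff of_nat_mult of_nat_numeral)
      have "\<not> 4 dvd l"
      proof
        assume "4 dvd l"
        then have "2 * 2 dvd k * 2" using \<open>l dvd k * 2\<close> by (metis dvd_trans mult_2 numeral_Bit0)
        then show False using k(1) by simp
      qed
      then have l4: "l mod 4 = 2" using False by presburger
      have even: "\<exists>j::int. B \<alpha> \<mu> = 2 * of_int j" if \<alpha>\<mu>: "\<alpha> \<in> \<Phi>" "\<mu> \<in> \<Lambda>" for \<alpha> \<mu>
      proof -
        have \<alpha>: "\<alpha> \<in> ?R" using \<alpha>\<mu>(1) by (simp add: root_lattice_def group_closure.base)
        obtain b :: int where b: "B \<alpha> \<mu> = of_int b" using Ints[OF \<alpha> \<alpha>\<mu>(2)] by blast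
        have "2 dvd int l" using False by simp
        then have "2 dvd int k * b" using dvd[OF \<alpha> \<alpha>\<mu>(2) b] dvd_trans by blast
        then have "even b" using k(1) by simp
        then show ?thesis using b by (auto elim!: evenE)
      qed
      show ?thesis
        using l4 form_even_imp_type_B[OF assms(3,2,6) even] by blast
    qed simp
  next
    fix F assume F: "finite F" "\<forall>x\<in>\<Lambda>. \<exists>y\<in>F. x - y \<in> ?R"
    have fin: "finite \<Delta>"
      using assms(2) finite_roots by (auto simp: simple_roots_def intro: finite_subset)
    obtain F' where F': "finite F'"
      "\<And>x. x \<in> group_closure \<Delta> \<Longrightarrow> \<exists>y\<in>F'. \<exists>z\<in>group_closure \<Delta>. x - y = real l *\<^sub>R z"
      using finite_residues_group_closure[OF fin assms(4)] by blast
    \<comment> \<open>Representatives modulo the root lattice are refined by representatives modulo its \<open>l\<close>-fold multiple.\<close>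
    let ?S = "(\<lambda>(y, z). y + z) ` (F \<times> F')"
    have "\<exists>y\<in>?S. x - y \<in> ?K" if x: "x \<in> \<Lambda>" for x
    proof -
      obtain y where y: "y \<in> F" "x - y \<in> ?R" using F x by blast
      then obtain z w where z: "z \<in> F'" "w \<in> ?R" "x - y - z = real l *\<^sub>R w"
        using F'(2) root_lattice_eq_group_closure_simple[OF assms(2)] by blast
      have "x - (y + z) \<in> ?K" using lR[OF z(2)] z(3) by (simp add: diff_diff_eq)
      then show ?thesis using y z by force
    qed
    then show "\<exists>F. finite F \<and> (\<forall>x\<in>\<Lambda>. \<exists>y\<in>F. x - y \<in> ?K)"
      using F F' by (intro exI[of _ ?S]) auto
  next
    fix k :: nat assume k: "odd k" "\<forall>x\<in>\<Lambda>. real k *\<^sub>R x \<in> ?R"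
      and l: "odd l \<or> (l mod 4 = 2 \<and> (\<exists>n. type_B n \<Delta>) \<and> \<Lambda> = ?R)"
    \<comment> \<open>The multiplier is \<open>l\<close> or \<open>l / 2\<close>, whichever is odd.\<close>
    have "\<exists>m. odd m \<and> (\<forall>x\<in>?R. real m *\<^sub>R x \<in> ?K)"
    proof (cases "odd l")
      case True
      then show ?thesis using lR by blast
    next
      case False
      with l obtain n where n: "l mod 4 = 2" "type_B n \<Delta>" "\<Lambda> = ?R" by blast
      define m where "m = l div 2"
      have m: "l = 2 * m" "odd m" using n(1) unfolding m_def by presburger+
      have "real m *\<^sub>R x \<in> ?K" if x: "x \<in> ?R" for x
      proof -
        have "\<exists>j::int. B (real m *\<^sub>R x) \<mu> = real l * of_int j" if "\<mu> \<in> ?R" for \<mu>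
          using type_B_form_even[OF assms(3,2) n(2) x that] by (auto simp: Bscale m(1))
        then show ?thesis using R_scale[OF x] n(3) by (simp add: Cent_def)
      qed
      with m(2) show ?thesis by blast
    qed
    then obtain m where m: "odd m" "\<forall>x\<in>?R. real m *\<^sub>R x \<in> ?K" by blast
    have "real (m * k) *\<^sub>R x \<in> ?K" if "x \<in> \<Lambda>" for x
    proof -
      have "real m *\<^sub>R (real k *\<^sub>R x) \<in> ?K" using m(2) k(2) that by blast
      then show ?thesis by simp
    qed
    moreover have "odd (m * k)" using m(1) k(1) by simp
    ultimately show "\<exists>k::nat. odd k \<and> (\<forall>x\<in>\<Lambda>. real k *\<^sub>R x \<in> ?K)" by blast
  qed
qed

end
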